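(* Let $\Bbbk$ be a field of characteristic zero, $H=\Bbbk[\partial]$, and let $V$ be a finite Novikov conformal algebra over $\Bbbk$ which is simple or semisimple. Let $\mathcal R\subseteq\mathrm{Cend}\,V$ be the conformal subalgebra generated by all right multiplication operators $R^a$, $a\in V$. Then $\mathcal R$ is a semisimple conformal algebra.
   Context: A conformal algebra is an $H$-module $C$ with a $\Bbbk$-bilinear $\lambda$-product $C\times C\to C[\lambda]$, $(x,y)\mapsto x_{(\lambda)}y$, which is sesqui-linear: $(\partial x)_{(\lambda)}y=-\lambda(x_{(\lambda)}y)$, $x_{(\lambda)}(\partial y)=(\partial+\lambda)(x_{(\lambda)}y)$. It is finite if it is finitely generated as an $H$-module. If $x_{(\lambda)}y=\sum_n\lambda^nc_n$, put $\{x_{(\lambda)}y\}=x_{(-\partial-\lambda)}y:=\sum_n(-\partial-\lambda)^nc_n$. A Novikov conformal algebra is a conformal algebra $V$, with product written $\circ_{(\lambda)}$, such that for all $a,b,c\in V$ (products extended coefficientwise) $$(a\circ_{(\lambda)}b)\circ_{(\lambda+\mu)}c-a\circ_{(\lambda)}(b\circ_{(\mu)}c)=(b\circ_{(\mu)}a)\circ_{(\lambda+\mu)}c-b\circ_{(\mu)}(a\circ_{(\lambda)}c),$$ $$(a\circ_{(\lambda)}b)\circ_{(\mu)}c=\{(a\circ_{(\lambda)}c)\circ_{(\mu-\lambda)}b\}.$$ An ideal of a conformal algebra $C$ is an $H$-submodule $I$ with $I_{(\lambda)}C\subseteq I[\lambda]$ and $C_{(\lambda)}I\subseteq I[\lambda]$.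 $C$ is simple if $C_{(\lambda)}C\ne0$ and $C$ has no nonzero proper ideals. For an ideal $I$ put $I^{(1)}=I$ and let $I^{(n+1)}$ be the linear span of all coefficients of $x_{(\lambda)}y$, $x,y\in I^{(n)}$; $I$ is solvable if $I^{(n)}=0$ for some $n\geq 1$. $C$ is semisimple if it has no nonzero solvable ideals. A conformal endomorphism of an $H$-module $V$ is a $\Bbbk$-linear map $f_\lambda:V\to V[\lambda]$ with $f_\lambda(\partial v)=(\partial+\lambda)f_\lambda(v)$. For finitely generated $V$, the space $\mathrm{Cend}\,V$ of all conformal endomorphisms is an associative conformal algebra via $(\partial f)_\lambda(v)=-\lambda f_\lambda(v)$ and $(f_{(\lambda)}g)_\mu(v)=f_\lambda(g_{\mu-\lambda}(v))$. For $a\in V$, $R^a\in\mathrm{Cend}\,V$ is given by $R^a_\lambda(v)=\{v\circ_{(\lambda)}a\}$. A conformal subalgebra is an $H$-submodule closed under (all coefficients of) the $\lambda$-product; the one generated by a set is the smallest one containing it. *)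

theory Defs
  imports "HOL-Computational_Algebra.Polynomial" "HOL-Library.Function_Algebras" "HOL.Hull"
begin

section \<open>Polynomials with coefficients in a module\<close>

text \<open>
  An \<open>H\<close>-module, \<open>H = k[\<partial>]\<close>, is a module over the ring \<^typ>\<open>'k poly\<close>; the indeterminate
  \<open>[:0, 1:]\<close> acts as \<open>\<partial>\<close> and \<open>[:c:]\<close> as the scalar \<open>c\<close>. For an abelian group \<open>V\<close>,
  \<^typ>\<open>'v poly\<close> is \<open>V[\<lambda>]\<close>. In two variables, \<^typ>\<open>'v poly poly\<close> is \<open>V[\<mu>][\<lambda>]\<close>:
  the outer variable is \<open>\<lambda>\<close> and the inner one is \<open>\<mu>\<close>.

  \<open>poly_subst T e P\<close> is \<open>\<Sum>n. T\<^sup>n (e c\<^sub>n)\<close> for \<open>P = \<Sum>n. \<nu>\<^sup>n c\<^sub>n\<close>: the operator \<open>T\<close> is substituted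
  for the variable \<open>\<nu>\<close> and the additive map \<open>e\<close> is applied to the coefficients.
\<close>

definition poly_subst :: "('m \<Rightarrow> 'm) \<Rightarrow> ('c::zero \<Rightarrow> 'm) \<Rightarrow> 'c poly \<Rightarrow> 'm::comm_monoid_add" where
  "poly_subst T e P = (\<Sum>n\<le>degree P. (T ^^ n) (e (coeff P n)))"

abbreviation del :: "('k::comm_ring_1 poly \<Rightarrow> 'v \<Rightarrow> 'v) \<Rightarrow> 'v \<Rightarrow> 'v" where
  "del scale \<equiv> scale [:0, 1:]"

abbreviation const2 :: "'v::zero \<Rightarrow> 'v poly poly" where
  "const2 v \<equiv> [:[:v:]:]"

abbreviation lam2 :: "'v::zero poly poly \<Rightarrow> 'v poly poly" where
  "lam2 \<equiv> pCons 0"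

abbreviation mu2 :: "'v::zero poly poly \<Rightarrow> 'v poly poly" where
  "mu2 \<equiv> map_poly (pCons 0)"

abbreviation del2 :: "('k::comm_ring_1 poly \<Rightarrow> 'v \<Rightarrow> 'v) \<Rightarrow> 'v::zero poly poly \<Rightarrow> 'v poly poly" where
  "del2 scale \<equiv> map_poly (map_poly (del scale))"


section \<open>Conformal algebras\<close>

locale conformal_algebra = module scale
  for scale :: "'k::field poly \<Rightarrow> 'c::ab_group_add \<Rightarrow> 'c" +
  fixes C :: "'c set" and lprod :: "'c \<Rightarrow> 'c \<Rightarrow> 'c poly"
  assumes subspace_carrier: "module.subspace scale C"
    and coeff_lprod_closed: "x \<in> C \<Longrightarrow> y \<in> C \<Longrightarrow> coeff (lprod x y) n \<in> C"
    and lprod_add_left: "x \<in> C \<Longrightarrow> x' \<in> C \<Longrightarrow> y \<in> C \<Longrightarrow>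
          lprod (x + x') y = lprod x y + lprod x' y"
    and lprod_add_right: "x \<in> C \<Longrightarrow> y \<in> C \<Longrightarrow> y' \<in> C \<Longrightarrow>
          lprod x (y + y') = lprod x y + lprod x y'"
    and lprod_scale_left: "x \<in> C \<Longrightarrow> y \<in> C \<Longrightarrow>
          lprod (scale [:c:] x) y = map_poly (scale [:c:]) (lprod x y)"
    and lprod_scale_right: "x \<in> C \<Longrightarrow> y \<in> C \<Longrightarrow>
          lprod x (scale [:c:] y) = map_poly (scale [:c:]) (lprod x y)"
    and lprod_del_left: "x \<in> C \<Longrightarrow> y \<in> C \<Longrightarrow>
          lprod (del scale x) y = - pCons 0 (lprod x y)"
    and lprod_del_right: "x \<in> C \<Longrightarrow> y \<in> C \<Longrightarrow>
          lprod x (del scale y) = map_poly (del scale) (lprod x y) + pCons 0 (lprod x y)"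

locale finite_conformal_algebra = conformal_algebra +
  assumes finitely_generated: "\<exists>S. finite S \<and> S \<subseteq> C \<and> module.span scale S = C"

definition conformal_ideal ::
    "('k::field poly \<Rightarrow> 'c::ab_group_add \<Rightarrow> 'c) \<Rightarrow> 'c set \<Rightarrow> ('c \<Rightarrow> 'c \<Rightarrow> 'c poly) \<Rightarrow> 'c set \<Rightarrow> bool" where
  "conformal_ideal scale C lprod I \<longleftrightarrow>
     module.subspace scale I \<and> I \<subseteq> C \<and>
     (\<forall>x\<in>I. \<forall>y\<in>C. \<forall>n. coeff (lprod x y) n \<in> I \<and> coeff (lprod y x) n \<in> I)"

text \<open>Indices start at \<open>0\<close>: the \<open>n\<close>-th term below is \<open>I\<^sup>(\<^sup>n\<^sup>+\<^sup>1\<^sup>)\<close>.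
  The span is over the field, not over \<open>H\<close>.\<close>

primrec conformal_derived ::
    "('k::field poly \<Rightarrow> 'c::ab_group_add \<Rightarrow> 'c) \<Rightarrow> ('c \<Rightarrow> 'c \<Rightarrow> 'c poly) \<Rightarrow> 'c set \<Rightarrow> nat \<Rightarrow> 'c set" where
  "conformal_derived scale lprod I 0 = I"
| "conformal_derived scale lprod I (Suc n) =
     module.span (\<lambda>c. scale [:c:])
       {coeff (lprod x y) m | x y m.
          x \<in> conformal_derived scale lprod I n \<and> y \<in> conformal_derived scale lprod I n}"

definition conformal_solvable ::
    "('k::field poly \<Rightarrow> 'c::ab_group_add \<Rightarrow> 'c) \<Rightarrow> ('c \<Rightarrow> 'c \<Rightarrow> 'c poly) \<Rightarrow> 'c set \<Rightarrow> bool" where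
  "conformal_solvable scale lprod I \<longleftrightarrow> (\<exists>n. conformal_derived scale lprod I n = {0})"

locale simple_conformal_algebra = conformal_algebra +
  assumes lprod_nonzero: "\<exists>x\<in>C. \<exists>y\<in>C. lprod x y \<noteq> 0"
    and ideal_trivial: "conformal_ideal scale C lprod I \<Longrightarrow> I = {0} \<or> I = C"

locale semisimple_conformal_algebra = conformal_algebra +
  assumes solvable_ideal_zero:
    "conformal_ideal scale C lprod I \<Longrightarrow> conformal_solvable scale lprod I \<Longrightarrow> I = {0}"


section \<open>Novikov conformal algebras\<close>

text \<open>
  The substitution \<open>\<nu> = X\<close> in the inner or outer product, where \<open>X\<close>, \<open>Y\<close> are operators on
  \<open>V[\<lambda>,\<mu>]\<close>: \<open>lprod_left lprod X Y a b c\<close> is \<open>(a\<^sub>X b)\<^sub>Y c\<close> and \<open>lprod_right lprod X Y a b c\<close> is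
  \<open>a\<^sub>X (b\<^sub>Y c)\<close>.
\<close>

definition lprod_left ::
    "('v \<Rightarrow> 'v \<Rightarrow> 'v poly) \<Rightarrow> ('v poly poly \<Rightarrow> 'v poly poly) \<Rightarrow> ('v poly poly \<Rightarrow> 'v poly poly) \<Rightarrow>
     'v \<Rightarrow> 'v \<Rightarrow> 'v \<Rightarrow> 'v::ab_group_add poly poly" where
  "lprod_left lprod X Y a b c = poly_subst X (\<lambda>u. poly_subst Y const2 (lprod u c)) (lprod a b)"

definition lprod_right ::
    "('v \<Rightarrow> 'v \<Rightarrow> 'v poly) \<Rightarrow> ('v poly poly \<Rightarrow> 'v poly poly) \<Rightarrow> ('v poly poly \<Rightarrow> 'v poly poly) \<Rightarrow>
     'v \<Rightarrow> 'v \<Rightarrow> 'v \<Rightarrow> 'v::ab_group_add poly poly" where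
  "lprod_right lprod X Y a b c = poly_subst Y (\<lambda>u. poly_subst X const2 (lprod a u)) (lprod b c)"

text \<open>
  In the second axiom \<open>{x\<^sub>\<nu> y} = x\<^sub>-\<^sub>\<partial>\<^sub>-\<^sub>\<nu> y\<close> is taken at \<open>\<nu> = \<mu> - \<lambda>\<close>. Sums and differences of operators
  are pointwise.
\<close>

locale novikov_conformal_algebra = conformal_algebra +
  assumes left_symmetric: "a \<in> C \<Longrightarrow> b \<in> C \<Longrightarrow> c \<in> C \<Longrightarrow>
      lprod_left lprod lam2 (lam2 + mu2) a b c - lprod_right lprod lam2 mu2 a b c =
      lprod_left lprod mu2 (lam2 + mu2) b a c - lprod_right lprod mu2 lam2 b a c"
    and right_commutative: "a \<in> C \<Longrightarrow> b \<in> C \<Longrightarrow> c \<in> C \<Longrightarrow>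
      lprod_left lprod lam2 mu2 a b c =
      lprod_left lprod lam2 (- del2 scale - (mu2 - lam2)) a c b"


section \<open>Conformal endomorphisms\<close>

definition Cend :: "('k::field poly \<Rightarrow> 'v::ab_group_add \<Rightarrow> 'v) \<Rightarrow> ('v \<Rightarrow> 'v poly) set" where
  "Cend scale = {f.
     (\<forall>v w. f (v + w) = f v + f w) \<and>
     (\<forall>c v. f (scale [:c:] v) = map_poly (scale [:c:]) (f v)) \<and>
     (\<forall>v. f (del scale v) = map_poly (del scale) (f v) + pCons 0 (f v))}"

text \<open>The \<open>H\<close>-module structure determined by \<open>(c f)\<^sub>\<lambda> v = c f\<^sub>\<lambda>(v)\<close> and
  \<open>(\<partial> f)\<^sub>\<lambda> v = -\<lambda> f\<^sub>\<lambda>(v)\<close>.\<close>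

definition Cend_scale ::
    "('k::field poly \<Rightarrow> 'v::ab_group_add \<Rightarrow> 'v) \<Rightarrow> 'k poly \<Rightarrow> ('v \<Rightarrow> 'v poly) \<Rightarrow> 'v \<Rightarrow> 'v poly" where
  "Cend_scale scale p f = (\<lambda>v. poly_subst (- pCons 0) (\<lambda>c. map_poly (scale [:c:]) (f v)) p)"

text \<open>
  \<open>Cend_eval f g v\<close> is \<open>f\<^sub>\<lambda>(g\<^sub>\<mu>\<^sub>-\<^sub>\<lambda>(v))\<close>. The product \<open>f\<^sub>(\<^sub>\<lambda>\<^sub>) g\<close> collects, for each \<open>n\<close>, the
  coefficients of \<open>\<lambda>\<^sup>n\<close>, which are polynomials in \<open>\<mu>\<close>. The use of \<open>Abs_poly\<close> requires that almost
  all of them vanish as functions of \<open>v\<close>; lemma \<open>coeff_Cend_lprod\<close> below shows this on \<open>Cend V\<close>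
  for finitely generated \<open>V\<close>.
\<close>

definition Cend_eval ::
    "('v \<Rightarrow> 'v poly) \<Rightarrow> ('v \<Rightarrow> 'v poly) \<Rightarrow> 'v \<Rightarrow> 'v::ab_group_add poly poly" where
  "Cend_eval f g v = poly_subst (mu2 - lam2) (\<lambda>w. poly_subst lam2 const2 (f w)) (g v)"

definition Cend_lprod ::
    "('v \<Rightarrow> 'v poly) \<Rightarrow> ('v \<Rightarrow> 'v poly) \<Rightarrow> ('v \<Rightarrow> 'v::ab_group_add poly) poly" where
  "Cend_lprod f g = Abs_poly (\<lambda>n v. coeff (Cend_eval f g v) n)"

definition conformal_subalgebra ::
    "('k::field poly \<Rightarrow> 'c::ab_group_add \<Rightarrow> 'c) \<Rightarrow> 'c set \<Rightarrow> ('c \<Rightarrow> 'c \<Rightarrow> 'c poly) \<Rightarrow> 'c set \<Rightarrow> bool" where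
  "conformal_subalgebra scale C lprod S \<longleftrightarrow>
     module.subspace scale S \<and> S \<subseteq> C \<and> (\<forall>x\<in>S. \<forall>y\<in>S. \<forall>n. coeff (lprod x y) n \<in> S)"

definition lbrace :: "('k::field poly \<Rightarrow> 'v \<Rightarrow> 'v) \<Rightarrow> 'v poly \<Rightarrow> 'v::ab_group_add poly" where
  "lbrace scale P = poly_subst (- map_poly (del scale) - pCons 0) (\<lambda>c. [:c:]) P"

definition right_mult ::
    "('k::field poly \<Rightarrow> 'v::ab_group_add \<Rightarrow> 'v) \<Rightarrow> ('v \<Rightarrow> 'v \<Rightarrow> 'v poly) \<Rightarrow> 'v \<Rightarrow> 'v \<Rightarrow> 'v poly" where
  "right_mult scale lprod a = (\<lambda>v. lbrace scale (lprod v a))"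

definition right_mult_algebra ::
    "('k::field poly \<Rightarrow> 'v::ab_group_add \<Rightarrow> 'v) \<Rightarrow> ('v \<Rightarrow> 'v \<Rightarrow> 'v poly) \<Rightarrow> ('v \<Rightarrow> 'v poly) set" where
  "right_mult_algebra scale lprod =
     conformal_subalgebra (Cend_scale scale) (Cend scale) Cend_lprod hull
       range (right_mult scale lprod)"


section \<open>Well-definedness of the conformal algebra of conformal endomorphisms\<close>


lemma map_poly_add_hom:
  assumes "\<And>x y. h (x + y) = h x + h y" "h 0 = 0"
  shows "map_poly h (p + q) = map_poly h p + map_poly h (q :: 'a::ab_group_add poly)"
  by (rule poly_eqI) (simp add: coeff_map_poly assms)

lemma poly_subst_eq_sum:
  assumes "e 0 = 0" "T 0 = 0" "degree P \<le> N"
  shows "poly_subst T e P = (\<Sum>n\<le>N. (T ^^ n) (e (coeff P n)))"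
proof -
  have z: "(T ^^ n) 0 = 0" for n by (induction n) (use assms in auto)
  show ?thesis unfolding poly_subst_def
    by (rule sum.mono_neutral_left) (use assms in \<open>auto simp: z coeff_eq_0\<close>)
qed

lemma poly_subst_0: "e 0 = 0 \<Longrightarrow> poly_subst T e 0 = 0"
  by (simp add: poly_subst_def)

lemma add_zero:
  fixes T :: "'a::ab_group_add \<Rightarrow> 'b::ab_group_add"
  assumes "\<And>x y. T (x + y) = T x + T y" shows "T 0 = 0"
  using assms[of 0 0] by simp

lemma poly_subst_pCons:
  fixes T :: "'a::ab_group_add \<Rightarrow> 'a"
  assumes T: "\<And>x y. T (x + y) = T x + T y" and e: "e 0 = 0"
  shows "poly_subst T e (pCons c P) = e c + T (poly_subst T e P)"
proof -
  have T0: "T 0 = 0" using add_zero[OF T] .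
  have Ts: "T (sum h A) = (\<Sum>x\<in>A. T (h x))" for h and A :: "nat set"
    by (induction A rule: infinite_finite_induct) (simp_all add: T0 T)
  have "poly_subst T e (pCons c P) = (\<Sum>n\<le>Suc (degree P). (T ^^ n) (e (coeff (pCons c P) n)))"
    by (rule poly_subst_eq_sum) (auto simp: e T0 degree_pCons_le)
  also have "\<dots> = e c + (\<Sum>n\<le>degree P. T ((T ^^ n) (e (coeff P n))))"
    by (subst sum.atMost_Suc_shift) simp
  finally show ?thesis by (simp add: poly_subst_def Ts)
qed

lemma poly_subst_add:
  fixes T :: "'a::ab_group_add \<Rightarrow> 'a"
  assumes T: "\<And>x y. T (x + y) = T x + T y"
    and e: "\<And>x y. e (x + y) = e x + e (y :: 'c::ab_group_add)"
  shows "poly_subst T e (P + Q) = poly_subst T e P + poly_subst T e Q"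
proof -
  have e0: "e 0 = 0" using add_zero[OF e] .
  show ?thesis
    by (induction P Q rule: poly_induct2)
      (simp_all add: poly_subst_0 e0 poly_subst_pCons[of T e, OF T e0] T e algebra_simps)
qed

lemma poly_subst_map:
  fixes T :: "'a::ab_group_add \<Rightarrow> 'a"
  assumes T: "\<And>x y. T (x + y) = T x + T y" and e: "e 0 = 0"
    and A: "\<And>x y. A (x + y) = A x + A y" and A0: "A 0 = 0"
    and AT: "\<And>x. A (T x) = T (A x)" and h: "h 0 = 0" and eh: "\<And>c. e (h c) = A (e c)"
  shows "poly_subst T e (map_poly h P) = A (poly_subst T e P)"
  by (induction P)
    (simp_all add: poly_subst_0 e A0 map_poly_pCons h poly_subst_pCons[of T e, OF T e] A AT eh)


lemma poly_subst_comp: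
  fixes T :: "'a::ab_group_add \<Rightarrow> 'a"
  assumes T: "\<And>x y. T (x + y) = T x + T y" and e: "e 0 = 0"
    and A: "\<And>x y. A (x + y) = A x + A y" and A0: "A 0 = 0"
    and AT: "\<And>x. A (T x) = T (A x)"
  shows "poly_subst T (\<lambda>c. A (e c)) P = A (poly_subst T e P)"
  by (induction P)
    (simp_all add: poly_subst_0 e A0 poly_subst_pCons[of T e, OF T e]
       poly_subst_pCons[of T "\<lambda>c. A (e c)", OF T] A AT)

lemma poly_subst_add_fun:
  fixes T :: "'a::ab_group_add \<Rightarrow> 'a"
  assumes T: "\<And>x y. T (x + y) = T x + T y" and e: "e 0 = 0" and e': "e' 0 = 0"
  shows "poly_subst T (\<lambda>c. e c + e' c) P = poly_subst T e P + poly_subst T e' P"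
  by (induction P)
    (simp_all add: poly_subst_0 e e' poly_subst_pCons[of T e, OF T e]  poly_subst_pCons[of T e', OF T e']
       poly_subst_pCons[of T "\<lambda>c. e c + e' c", OF T] T algebra_simps)

locale H_module = module scale for scale :: "'k::field poly \<Rightarrow> 'v::ab_group_add \<Rightarrow> 'v"
begin

abbreviation "D \<equiv> scale [:0,1:]"

lemma scale_pCons: "scale (pCons c q) v = scale [:c:] v + D (scale q v)"
  by (subst scale_scale, subst scale_left_distrib[symmetric]) simp

lemma DK: "D (scale [:c:] v) = scale [:c:] (D v)"
  by (simp add: ac_simps)

lemma map_scale_add: "map_poly (scale p) (P + Q) = map_poly (scale p) P + map_poly (scale p) Q"
  by (rule map_poly_add_hom) (simp_all add: scale_right_distrib)

lemma map2_add: "map_poly (map_poly (scale p)) (P + Q) = map_poly (map_poly (scale p)) P + map_poly (map_poly (scale p)) Q"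
  by (rule map_poly_add_hom) (simp_all add: map_scale_add)

lemma mu2_add: "map_poly (pCons 0) (P + Q) = map_poly (pCons 0) P + map_poly (pCons 0) (Q :: 'v poly poly)"
  by (rule map_poly_add_hom) (simp_all)

lemma T_add: "(mu2 - lam2) (x + y) = (mu2 - lam2) x + (mu2 - lam2) (y :: 'v poly poly)"
  by (simp add: mu2_add)

lemma lam_add: "lam2 (x + y) = lam2 x + lam2 (y :: 'v poly poly)"
  by (simp )

lemma mu_lam: "mu2 (lam2 x) = lam2 (mu2 (x :: 'v poly poly))"
  by (simp add: map_poly_pCons)

lemma S_lam: "map_poly (map_poly (scale p)) (lam2 x) = lam2 (map_poly (map_poly (scale p)) x)"
  by (simp add: map_poly_pCons)

lemma S_mu: "map_poly (map_poly (scale p)) (mu2 x) = mu2 (map_poly (map_poly (scale p)) x)"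
  by (rule poly_eqI) (simp add: coeff_map_poly map_poly_pCons)

lemma map_scale_diff: "map_poly (scale p) (P - Q) = map_poly (scale p) P - map_poly (scale p) Q"
  by (rule poly_eqI) (simp add: coeff_map_poly scale_right_diff_distrib)

lemma map2_diff: "map_poly (map_poly (scale p)) (P - Q) = map_poly (map_poly (scale p)) P - map_poly (map_poly (scale p)) Q"
  by (rule poly_eqI) (simp add: coeff_map_poly map_scale_diff)

lemma mu2_diff: "map_poly (pCons 0) (P - Q) = map_poly (pCons 0) P - map_poly (pCons 0) (Q :: 'v poly poly)"
  by (rule poly_eqI) (simp add: coeff_map_poly)

definition "E P = poly_subst lam2 const2 (P :: 'v poly)"

lemma E_add: "E (P + Q) = E P + E Q"
  unfolding E_def by (rule poly_subst_add) simp_all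

lemma E_0 [simp]: "E 0 = 0" by (simp add: E_def poly_subst_0)

lemma E_lam: "E (pCons 0 P) = lam2 (E P)"
  unfolding E_def by (subst poly_subst_pCons) simp_all

lemma E_scale: "E (map_poly (scale p) P) = map_poly (map_poly (scale p)) (E P)"
  unfolding E_def by (rule poly_subst_map) (simp_all add: map2_add S_lam map_poly_pCons)

lemma Cend_evalE: "Cend_eval f g v = poly_subst (mu2 - lam2) (\<lambda>w. E (f w)) (g v)"
  by (simp add: Cend_eval_def E_def)

lemma CendD:
  assumes "f \<in> Cend scale"
  shows "f (v + w) = f v + f w" "f (scale [:c:] v) = map_poly (scale [:c:]) (f v)"
    "f (D v) = map_poly D (f v) + pCons 0 (f v)" "f 0 = 0"
  using assms add_zero[of f] by (auto simp: Cend_def)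

lemma eval_add:
  assumes f: "f \<in> Cend scale" and g: "g \<in> Cend scale"
  shows "Cend_eval f g (v + w) = Cend_eval f g v + Cend_eval f g w"
  unfolding Cend_evalE CendD(1)[OF g]
  by (rule poly_subst_add) (simp_all only: T_add CendD(1)[OF f] E_add)

lemma eval_K:
  assumes f: "f \<in> Cend scale" and g: "g \<in> Cend scale"
  shows "Cend_eval f g (scale [:c:] v) = map_poly (map_poly (scale [:c:])) (Cend_eval f g v)"
  unfolding Cend_evalE CendD(2)[OF g]
  by (rule poly_subst_map)
    (simp_all only: T_add CendD[OF f] E_0 E_scale map2_add scale_zero_right map_poly_0,
     simp add: map2_diff S_mu S_lam)

lemma eval_D:
  assumes f: "f \<in> Cend scale" and g: "g \<in> Cend scale"
  shows "Cend_eval f g (D v) = map_poly (map_poly D) (Cend_eval f g v) + mu2 (Cend_eval f g v)"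
proof -
  have e: "E (f (x + y)) = E (f x) + E (f y)" for x y by (simp add: CendD(1)[OF f] E_add)
  have "poly_subst (mu2 - lam2) (\<lambda>w. E (f w)) (map_poly D (g v)) =
     (del2 scale + lam2) (Cend_eval f g v)"
    unfolding Cend_evalE
    apply (rule poly_subst_map)
          apply (simp_all only: T_add CendD[OF f] E_0 E_scale map2_add scale_zero_right map_poly_0 E_lam E_add)
     apply (simp_all add: map2_diff S_mu S_lam mu2_add map2_add mu_lam)
    done
  moreover have "poly_subst (mu2 - lam2) (\<lambda>w. E (f w)) (pCons 0 (g v)) = (mu2 - lam2) (Cend_eval f g v)"
    unfolding Cend_evalE
    by (subst poly_subst_pCons) (simp_all only: T_add CendD[OF f] E_0 add_0)
  ultimately have "Cend_eval f g (D v) = (del2 scale + lam2) (Cend_eval f g v) + (mu2 - lam2) (Cend_eval f g v)"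
    unfolding Cend_evalE CendD(3)[OF g]
    by (subst poly_subst_add) (simp_all only: T_add e)
  then show ?thesis by simp
qed

lemma coeff_Cend_lprod:
  assumes f: "f \<in> Cend scale" and g: "g \<in> Cend scale" and "finite S" "span S = UNIV"
  shows "coeff (Cend_lprod f g) n v = coeff (Cend_eval f g v) n"
proof -
  define N where "N = Max (insert 0 ((\<lambda>v. degree (Cend_eval f g v)) ` S))"
  define P where "P v \<longleftrightarrow> degree (Cend_eval f g v) \<le> N" for v
  have P0: "P 0" using add_zero[of "Cend_eval f g", OF eval_add[OF f g]] by (simp add: P_def)
  have Padd: "P v \<Longrightarrow> P w \<Longrightarrow> P (v + w)" for v w
    by (simp add: P_def eval_add[OF f g] degree_add_le)
  have PK: "P (scale [:c:] v)" if "P v" for c v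
    using that map_poly_degree_leq order_trans by (fastforce simp add: P_def eval_K[OF f g])
  have PD: "P (D v)" if "P v" for v
    using that unfolding P_def eval_D[OF f g]
    by (intro degree_add_le order_trans[OF map_poly_degree_leq])
  have "P (scale p v)" if "P v" for p v
  proof (induction p)
    case 0 then show ?case by (simp add: P0)
  next
    case (pCons c p) then show ?case
      by (subst scale_pCons) (intro Padd PK PD that)
  qed
  then have "subspace (Collect P)" using P0 Padd by (auto simp: subspace_def)
  moreover have "P v" if "v \<in> S" for v
    using that assms(3) by (auto simp: P_def N_def)
  ultimately have all: "P v" for v using span_induct[of v S P] assms(4) by auto
  have "(\<lambda>v. coeff (Cend_eval f g v) n) = 0" if "n > N" for n
    using that all by (auto simp: P_def fun_eq_iff intro!: coeff_eq_0 intro: le_less_trans)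
  then have "\<forall>\<^sub>\<infinity>n. (\<lambda>v. coeff (Cend_eval f g v) n) = 0"
    unfolding MOST_nat by blast
  then show ?thesis
    unfolding Cend_lprod_def by (simp add: Abs_poly_inverse)
qed

lemma coeff_in_Cend:
  assumes f: "f \<in> Cend scale" and g: "g \<in> Cend scale" and S: "finite S" "span S = UNIV"
  shows "coeff (Cend_lprod f g) n \<in> Cend scale"
  unfolding Cend_def
  by (auto simp: coeff_Cend_lprod[OF assms] eval_add[OF f g] eval_K[OF f g] eval_D[OF f g] coeff_map_poly)

lemma Cend_scale_const: "Cend_scale scale [:c:] f = (\<lambda>v. map_poly (scale [:c:]) (f v))"
  by (simp add: Cend_scale_def poly_subst_def)

lemma neg_add: "(- pCons 0) (x + y) = (- pCons 0) x + (- pCons 0) (y :: 'v poly)" by simp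

lemma k0: "map_poly (scale [:0:]) P = 0" by (rule poly_eqI) (simp add: coeff_map_poly)

lemma Cend_scale_pCons: "Cend_scale scale (pCons c p) f v = map_poly (scale [:c:]) (f v) - pCons 0 (Cend_scale scale p f v)"
  unfolding Cend_scale_def
  by (subst poly_subst_pCons[OF neg_add]) (simp_all add: k0 del: pCons_0_0)

lemma Cend_scale_0: "Cend_scale scale 0 f v = 0"
  by (simp add: Cend_scale_def poly_subst_0 k0 del: pCons_0_0)

lemma s1: "scale [:1:] v = v" using scale_one[of v] by (simp add: one_pCons)

lemma k1: "map_poly (scale [:1:]) P = P" by (rule poly_eqI) (simp add: coeff_map_poly s1)

lemma Cend_scale_1: "Cend_scale scale 1 f = f"
  by (simp add: one_pCons Cend_scale_const k1)

lemma Cend_scale_D: "Cend_scale scale [:0,1:] f = (\<lambda>v. - pCons 0 (f v))"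
  by (rule ext, subst Cend_scale_pCons) (simp add: Cend_scale_const k0 k1 del: pCons_0_0)

lemma kadd: "map_poly (scale [:a + b:]) P = map_poly (scale [:a:]) P + map_poly (scale [:b:]) P"
  by (rule poly_eqI) (simp add: coeff_map_poly scale_left_distrib[symmetric])

lemma Cs_addr: "Cend_scale scale p (f + f') = Cend_scale scale p f + Cend_scale scale p f'"
  by (rule ext, induction p) (simp_all add: Cend_scale_0 Cend_scale_pCons map_scale_add)

lemma Cs_addl: "Cend_scale scale (p + q) f v = Cend_scale scale p f v + Cend_scale scale q f v"
  by (induction p q rule: poly_induct2) (simp_all add: Cend_scale_0 Cend_scale_pCons kadd)

lemma Cs_smult: "Cend_scale scale (smult c q) f v = map_poly (scale [:c:]) (Cend_scale scale q f v)"
proof (induction q)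
  case 0 then show ?case by (simp add: Cend_scale_0)
next
  case (pCons a q)
  then show ?case by (simp add: Cend_scale_pCons map_scale_diff map_poly_pCons map_poly_map_poly o_def mult.commute)
qed

lemma Cs_mult: "Cend_scale scale (p * q) f v = Cend_scale scale p (Cend_scale scale q f) v"
  by (induction p) (simp_all add: Cend_scale_0 Cend_scale_pCons Cs_addl Cs_smult k0 del: pCons_0_0)

lemma module_Cend: "module (Cend_scale scale)"
  by unfold_locales
    (auto simp: Cs_addr Cs_addl Cs_mult fun_eq_iff Cend_scale_1)

lemma sub_Cend: "module.subspace (Cend_scale scale) (Cend scale)"
proof -
  have "Cend_scale scale p f \<in> Cend scale" if "f \<in> Cend scale" for p f
  proof (induction p)
    case 0 then show ?case by (simp add: Cend_def Cend_scale_0)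
  next
    case (pCons c p)
    have 1: "map_poly (scale [:c:]) (map_poly D P) = map_poly D (map_poly (scale [:c:]) P)"
      "map_poly (scale [:c:]) (map_poly (scale [:d:]) P) = map_poly (scale [:d:]) (map_poly (scale [:c:]) P)"
      for P d
      by (rule poly_eqI; simp add: coeff_map_poly mult.commute)+
    show ?case unfolding Cend_def
      by (auto simp: Cend_scale_pCons CendD[OF that] CendD[OF pCons(2)] map_scale_add map_scale_diff map_poly_pCons 1
          algebra_simps)
  qed
  then show ?thesis
    unfolding module.subspace_def[OF module_Cend]
    by (auto simp: Cend_def map_scale_add)
qed

lemma conformal_algebra_Cend:
  assumes S: "finite S" "span S = UNIV"
  shows "conformal_algebra (Cend_scale scale) (Cend scale) Cend_lprod"
proof -
  note C = coeff_Cend_lprod[OF _ _ S]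
  have sub: "f + g \<in> Cend scale" "Cend_scale scale p f \<in> Cend scale" if "f \<in> Cend scale" "g \<in> Cend scale" for f g p
    using sub_Cend that unfolding module.subspace_def[OF module_Cend] by auto
  interpret C: module "Cend_scale scale" by (rule module_Cend)
  have E1: "E (P + Q) = E P + E Q" for P Q by (rule E_add)
  have Em: "E (- P) = - E P" for P using E_add[of P "- P"] by (simp add: eq_neg_iff_add_eq_0 add.commute)
  have evl: "Cend_eval (f + f') g v = Cend_eval f g v + Cend_eval f' g v"
    if "f \<in> Cend scale" "f' \<in> Cend scale" for f f' g v
    unfolding Cend_evalE plus_fun_apply E_add
    by (rule poly_subst_add_fun) (simp_all only: T_add CendD[OF that(1)] CendD[OF that(2)] E_0)
  have evr: "Cend_eval f (g + g') v = Cend_eval f g v + Cend_eval f g' v"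
    if "f \<in> Cend scale" for f g g' v
    unfolding Cend_evalE plus_fun_apply
    by (rule poly_subst_add) (simp_all only: T_add CendD[OF that(1)] E_add)
  have evKl: "Cend_eval (Cend_scale scale [:c:] f) g v = map_poly (map_poly (scale [:c:])) (Cend_eval f g v)"
    if "f \<in> Cend scale" for f g v c
    unfolding Cend_evalE Cend_scale_const E_scale
    by (rule poly_subst_comp) (simp_all only: T_add CendD[OF that(1)] E_0 map2_add map_poly_0,
     simp add: map2_diff S_mu S_lam)
  have evKr: "Cend_eval f (Cend_scale scale [:c:] g) v = map_poly (map_poly (scale [:c:])) (Cend_eval f g v)"
    if "f \<in> Cend scale" for f g v c
    unfolding Cend_evalE Cend_scale_const
    by (rule poly_subst_map) (simp_all only: T_add CendD[OF that(1)] E_0 map2_add map_poly_0 E_scale scale_zero_right,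
     simp add: map2_diff S_mu S_lam)
  have evDl: "Cend_eval (Cend_scale scale [:0,1:] f) g v = (- lam2) (Cend_eval f g v)"
    if "f \<in> Cend scale" for f g v
    unfolding Cend_evalE Cend_scale_D Em E_lam fun_Compl_def
    apply (rule poly_subst_comp)
    subgoal by (rule T_add)
    using mu2_diff[of 0] by (simp_all add: CendD[OF that(1)] mu_lam)
  have evDr: "Cend_eval f (Cend_scale scale [:0,1:] g) v = - (mu2 - lam2) (Cend_eval f g v)"
    if "f \<in> Cend scale" for f g v
  proof -
    have e: "E (f (x + y)) = E (f x) + E (f y)" for x y by (simp add: CendD(1)[OF that] E_add)
    have "poly_subst (mu2 - lam2) (\<lambda>w. E (f w)) (- P + P) =
      poly_subst (mu2 - lam2) (\<lambda>w. E (f w)) (- P) + poly_subst (mu2 - lam2) (\<lambda>w. E (f w)) P" for P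
      by (rule poly_subst_add) (simp_all only: T_add e)
    then have neg: "poly_subst (mu2 - lam2) (\<lambda>w. E (f w)) (- P) = - poly_subst (mu2 - lam2) (\<lambda>w. E (f w)) P" for P
      by (simp add: poly_subst_0 CendD(4)[OF that] eq_neg_iff_add_eq_0)
    show ?thesis
    unfolding Cend_evalE Cend_scale_D neg
    by (subst poly_subst_pCons) (simp_all only: T_add CendD[OF that] E_0 add_0)
  qed
  have mp: "coeff (map_poly (Cend_scale scale [:c:]) P) n v = map_poly (scale [:c:]) (coeff P n v)" for c P n v
    by (simp add: coeff_map_poly Cend_scale_const)
  have mD: "coeff (map_poly (Cend_scale scale [:0,1:]) P) n v = - pCons 0 (coeff P n v)" for P n v
    by (simp add: coeff_map_poly Cend_scale_D)
  show ?thesis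
  proof (unfold_locales, goal_cases)
    case 1 show ?case by (rule sub_Cend)
  next
    case 2 then show ?case using coeff_in_Cend S by blast
  next
    case 3 then show ?case by (intro poly_eqI ext) (simp add: C sub evl)
  next
    case 4 then show ?case by (intro poly_eqI ext) (simp add: C sub evr)
  next
    case 5 then show ?case by (intro poly_eqI ext) (simp only: C sub evKl mp, simp add: coeff_map_poly)
  next
    case 6 then show ?case by (intro poly_eqI ext) (simp only: C sub evKr mp, simp add: coeff_map_poly)
  next
    case 7 then show ?case
      by (intro poly_eqI ext) (simp only: C sub evDl, simp add: coeff_pCons C split: nat.split)
  next
    case 8 then show ?case
      by (intro poly_eqI ext) (simp only: C sub evDr coeff_add mD plus_fun_apply, simp add: coeff_map_poly coeff_pCons C split: nat.split)
  qed
qed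

end

lemma right_mult_in_Cend:
  assumes "conformal_algebra scale UNIV circ"
  shows "right_mult scale circ a \<in> Cend scale"
proof -
  interpret conformal_algebra scale UNIV circ by fact
  interpret H_module scale by unfold_locales
  let ?T = "- map_poly (del scale) - pCons 0"
  have T: "?T (x + y) = ?T x + ?T y" for x y by (simp add: map_scale_add)
  have br_add: "lbrace scale (P + Q) = lbrace scale P + lbrace scale Q" for P Q
    unfolding lbrace_def by (rule poly_subst_add) (simp_all only: T, simp)
  have br_p: "lbrace scale (pCons 0 P) = ?T (lbrace scale P)" for P
    unfolding lbrace_def by (subst poly_subst_pCons[of ?T, OF T]) auto
  have br_m: "lbrace scale (- P) = - lbrace scale P" for P
    using br_add[of P "-P"] by (simp add: lbrace_def poly_subst_0 eq_neg_iff_add_eq_0 add.commute)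
  have br_k: "lbrace scale (map_poly (scale [:c:]) P) = map_poly (scale [:c:]) (lbrace scale P)" for P c
    unfolding lbrace_def
  proof (rule poly_subst_map)
    show "map_poly (scale [:c:]) (?T x) = ?T (map_poly (scale [:c:]) x)" for x
      by (rule poly_eqI) (simp add: coeff_map_poly coeff_pCons scale_right_diff_distrib mult.commute split: nat.split)
  qed (simp_all only: T map_scale_add, simp_all add: map_poly_pCons)
  show ?thesis
    unfolding Cend_def right_mult_def
    using map_scale_diff[of _ 0]
    by (simp add: lprod_add_left lprod_scale_left lprod_del_left br_add br_m br_k br_p)
qed

corollary Cend_conformal_algebra:
  assumes "finite_conformal_algebra scale UNIV circ"
  shows "conformal_algebra (Cend_scale scale) (Cend scale) Cend_lprod"
proof -
  interpret finite_conformal_algebra scale UNIV circ by fact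
  interpret H_module scale by unfold_locales
  show ?thesis using finitely_generated conformal_algebra_Cend by blast
qed

end

theory Submission
  imports Defs
begin

text \<open>
  Replace the formal variable of every \<open>\<lambda>\<close>-product by scalars. For \<open>c\<close> in the field, the left
  multiplication \<open>a \<circ>\<^sub>\<lambda> _\<close> and the right multiplication \<open>R\<^sup>a\<^sub>\<lambda>\<close> become additive operators
  \<open>L a c\<close>, \<open>R a c\<close> on \<open>V\<close> that satisfy \<open>x \<partial> = (\<partial> + c) x\<close>, and the Novikov axioms become
  (lemmas \<open>R_commute\<close>, \<open>L_R\<close>, \<open>L_R_commutator\<close>)

  \<^item> \<open>R b k\<close> and \<open>R c n\<close> commute;
  \<^item> \<open>L (R b k a) m = R b k \<circ> L a (m - k)\<close>;
  \<^item> \<open>[L a l, R c n] = R (L a l c) (l + n) - R c n \<circ> R a l\<close>.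

  Nothing is lost: an infinite field has enough points to recover the coefficients of a polynomial
  from its values, even modulo a subspace (\<open>poly_values_in_subspace\<close>).

  The right multiplications thus generate a commutative algebra of operators, graded by the shift
  \<open>c\<close>, on which every \<open>[L a l, _]\<close> acts as a derivation. In characteristic zero a derivation of a
  commutative algebra preserves nilpotency (\<open>nil_commutator\<close>). Hence the span \<open>N\<close> of the images of
  the homogeneous nilpotent operators is an ideal of \<open>V\<close>: right multiplications commute with them
  and left multiplications only add commutators.

  This ideal is solvable. The torsion submodule of \<open>V\<close> is an ideal with zero product, so it
  vanishes when \<open>V\<close> is semisimple. On a finitely generated torsion-free \<open>H\<close>-module, each factor in
  a product of commuting nilpotent operators lowers the rank of the image, so a long enough product
  is zero (\<open>nil_products_vanish\<close>). By the second identity, the product of the image of a \<open>k\<close>-fold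
  product of nilpotents with \<open>N\<close> lies in the span of images of \<open>(k + 1)\<close>-fold products, so the
  derived series of \<open>N\<close> reaches \<open>0\<close>. If \<open>V\<close> is semisimple then \<open>N = 0\<close>, that is, there are no
  nonzero homogeneous nilpotent operators.

  If \<open>f\<close> lies in a solvable ideal of the algebra generated by the \<open>R\<^sup>a\<close>, then the square of the
  operator \<open>f\<^sub>c\<close> is \<open>h\<^sub>2\<^sub>c\<close> for some \<open>h\<close> in the next derived subspace, so \<open>f\<^sub>c\<close> is nilpotent for every
  \<open>c\<close>, hence zero, and \<open>f = 0\<close>. A simple algebra equals its own derived subalgebra, so it is
  semisimple.
\<close>

section \<open>Polynomials with coefficients in a module and their values\<close>

lemma poly_subst_hom:
  fixes T :: "'a::ab_group_add \<Rightarrow> 'a" and T' :: "'b::ab_group_add \<Rightarrow> 'b"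
  assumes T: "\<And>x y. T (x + y) = T x + T y" and T': "\<And>x y. T' (x + y) = T' x + T' y"
    and h: "\<And>x y. h (x + y) = h x + h y" and hT: "\<And>x. h (T x) = T' (h x)" and e: "e 0 = 0"
  shows "h (poly_subst T e P) = poly_subst T' (\<lambda>c. h (e c)) P"
proof (induction P)
  case 0 then show ?case by (simp add: poly_subst_0 e add_zero[of h, OF h])
next
  case (pCons a P)
  then show ?case
    by (simp add: poly_subst_pCons[of T e, OF T e] h hT
        poly_subst_pCons[of T' "\<lambda>c. h (e c)", OF T'] e add_zero[of h, OF h])
qed

lemma sum_fun_apply: "(\<Sum>i\<in>A. F i) v = (\<Sum>i\<in>A. F i v)" for F :: "'i \<Rightarrow> 'a \<Rightarrow> 'b::ab_group_add"
  by (induction A rule: infinite_finite_induct) simp_all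

lemma inj_power_two: "inj (\<lambda>s. 2 ^ s :: 'k::field_char_0)"
proof (rule injI)
  fix s t assume "(2::'k) ^ s = 2 ^ t"
  then have "of_nat (2 ^ s) = (of_nat (2 ^ t) :: 'k)" by simp
  then have "(2::nat) ^ s = 2 ^ t" by (simp only: of_nat_eq_iff)
  then show "s = t" by (subst (asm) power_inject_exp) simp_all
qed

text \<open>
  A polynomial with values in a subspace has coefficients in it. Instead of inverting a Vandermonde
  matrix, pass from \<open>P(x)\<close> to \<open>P(2x) - 2\<^sup>d P(x)\<close>, which has smaller degree and whose \<open>n\<close>-th
  coefficient is that of \<open>P\<close> times \<open>2\<^sup>n - 2\<^sup>d\<close>; in characteristic zero this factor is invertible for
  \<open>n < d\<close>. This only needs values on a set that is closed under doubling.
\<close>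

lemma poly_values_in_subspace:
  fixes smul :: "'k::field_char_0 \<Rightarrow> 'a::ab_group_add \<Rightarrow> 'a"
  assumes "module smul" and U: "module.subspace smul U"
    and A: "a \<in> A" "0 \<notin> A" "\<And>x. x \<in> A \<Longrightarrow> 2 * x \<in> A"
    and val: "\<And>x. x \<in> A \<Longrightarrow> (\<Sum>n\<le>d. smul (x ^ n) (c n)) \<in> U"
    and "n \<le> d"
  shows "c n \<in> U"
proof -
  interpret module smul by fact
  have unscale: "v \<in> U" if "smul x v \<in> U" "x \<noteq> 0" for x v
    using subspace_scale[OF U that(1), of "inverse x"] that(2) by simp
  show ?thesis using val \<open>n \<le> d\<close>
  proof (induction d arbitrary: c n)
    case 0 then show ?case using A(1) by simp
  next
    case (Suc d)
    have low: "c n \<in> U" if "n \<le> d" for n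
    proof (rule unscale)
      show "smul (2 ^ n - 2 ^ Suc d) (c n) \<in> U"
      proof (rule Suc.IH[OF _ that])
        fix x assume x: "x \<in> A"
        have "(\<Sum>n\<le>Suc d. smul ((2 * x) ^ n) (c n)) - smul (2 ^ Suc d) (\<Sum>n\<le>Suc d. smul (x ^ n) (c n)) \<in> U"
          using Suc.prems(1)[OF x] Suc.prems(1)[OF A(3)[OF x]]
          by (intro subspace_diff[OF U] subspace_scale[OF U])
        also have "(\<Sum>n\<le>Suc d. smul ((2 * x) ^ n) (c n)) - smul (2 ^ Suc d) (\<Sum>n\<le>Suc d. smul (x ^ n) (c n))
            = (\<Sum>n\<le>Suc d. smul (x ^ n) (smul (2 ^ n - 2 ^ Suc d) (c n)))"
          by (simp only: scale_sum_right sum_subtractf[symmetric] scale_scale scale_left_diff_distrib[symmetric])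
            (simp add: power_mult_distrib algebra_simps)
        also have "\<dots> = (\<Sum>n\<le>d. smul (x ^ n) (smul (2 ^ n - 2 ^ Suc d) (c n)))" by simp
        finally show "(\<Sum>n\<le>d. smul (x ^ n) (smul (2 ^ n - 2 ^ Suc d) (c n))) \<in> U" .
      qed
      have "(2::'k) ^ n \<noteq> 2 ^ Suc d"
        using that injD[OF inj_power_two, of n "Suc d"] by auto
      then show "(2::'k) ^ n - 2 ^ Suc d \<noteq> 0" by simp
    qed
    have "(\<Sum>n\<le>Suc d. smul (a ^ n) (c n)) - (\<Sum>n\<le>d. smul (a ^ n) (c n)) \<in> U"
      by (intro subspace_diff[OF U] Suc.prems(1) A(1) subspace_sum[OF U] subspace_scale[OF U] low) simp
    then have "smul (a ^ Suc d) (c (Suc d)) \<in> U" by simp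
    then have "c (Suc d) \<in> U" by (rule unscale) (use A(1,2) in auto)
    then show ?case using low Suc.prems(2) by (cases "n = Suc d") auto
  qed
qed

context H_module begin

abbreviation "K c \<equiv> scale [:c:]"

lemma module_K: "module (\<lambda>c. K c)"
  by unfold_locales (auto simp: scale_right_distrib scale_left_distrib[symmetric] s1 mult.commute)

lemma subspace_if_K_D:
  assumes U: "module.subspace (\<lambda>c. K c) U" and D: "\<And>u. u \<in> U \<Longrightarrow> D u \<in> U"
  shows "subspace U"
proof -
  interpret K: module "\<lambda>c. K c" by (rule module_K)
  have "scale p u \<in> U" if "u \<in> U" for p u
  proof (induction p)
    case 0 then show ?case using K.subspace_0[OF U] by simp
  next
    case (pCons c p)
    show ?case
      by (subst scale_pCons) (intro K.subspace_add[OF U] K.subspace_scale[OF U] D pCons that)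
  qed
  then show ?thesis using K.subspace_0[OF U] K.subspace_add[OF U] by (auto simp: subspace_def)
qed

text \<open>
  The value of \<open>P \<in> V[\<lambda>]\<close> at \<open>\<lambda> = p(\<partial>)\<close>, the powers of \<open>p(\<partial>)\<close> being applied to the coefficients.
  Taking \<open>p \<in> H\<close> rather than a scalar covers both \<open>a \<circ>\<^sub>c b\<close> (with \<open>p = c\<close>) and \<open>{a \<circ>\<^sub>c b}\<close> (with
  \<open>p = - c - \<partial>\<close>).
\<close>

definition ev :: "'k poly \<Rightarrow> 'v poly \<Rightarrow> 'v" where
  "ev p P = poly_subst (scale p) (\<lambda>c. c) P"

lemma ev_pCons: "ev p (pCons c P) = c + scale p (ev p P)"
  unfolding ev_def by (rule poly_subst_pCons) (simp_all add: scale_right_distrib)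

lemma ev_0 [simp]: "ev p 0 = 0"
  by (simp add: ev_def poly_subst_0)

lemma ev_add: "ev p (P + Q) = ev p P + ev p Q"
  unfolding ev_def by (rule poly_subst_add) (simp_all add: scale_right_distrib)

lemma ev_minus: "ev p (- P) = - ev p P"
  using ev_add[of p P "- P"] by (simp add: eq_neg_iff_add_eq_0 add.commute)

lemma ev_diff: "ev p (P - Q) = ev p P - ev p Q"
  using ev_add[of p P "- Q"] by (simp add: ev_minus)

lemma ev_map_scale: "ev p (map_poly (scale q) P) = scale q (ev p P)"
  unfolding ev_def by (rule poly_subst_map) (simp_all add: scale_right_distrib mult.commute)

lemma funpow_K: "((\<lambda>v. K c v) ^^ n) v = K (c ^ n) v"
  by (induction n) (simp_all add: s1 mult.commute)

lemma ev_eq_sum: "degree P \<le> N \<Longrightarrow> ev [:c:] P = (\<Sum>n\<le>N. K (c ^ n) (coeff P n))"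
  unfolding ev_def by (subst poly_subst_eq_sum) (simp_all add: funpow_K)

text \<open>
  An additive map that intertwines \<open>p(\<partial>)\<close> and \<open>q(\<partial>)\<close> can be pulled inside a value. Together with
  \<open>ev2_poly_subst\<close> this turns nested \<open>\<lambda>\<close>-products into compositions of operators and back.
\<close>

lemma ev_poly_subst:
  assumes "\<And>x y. h (x + y) = h x + h y" "\<And>x. h (scale p x) = scale q (h x)"
  shows "h (ev p P) = poly_subst (scale q) h P"
  unfolding ev_def
  by (rule poly_subst_hom) (simp_all add: scale_right_distrib assms)

text \<open>
  The value at \<open>\<lambda> = p(\<partial>)\<close>, \<open>\<mu> = q(\<partial>)\<close>.
\<close>

definition ev2 :: "'k poly \<Rightarrow> 'k poly \<Rightarrow> 'v poly poly \<Rightarrow> 'v" where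
  "ev2 p q Q = poly_subst (scale p) (ev q) Q"

lemma ev2_pCons: "ev2 p q (pCons c P) = ev q c + scale p (ev2 p q P)"
  unfolding ev2_def by (rule poly_subst_pCons) (simp_all add: scale_right_distrib)

lemma ev2_0 [simp]: "ev2 p q 0 = 0"
  by (simp add: ev2_def poly_subst_0)

lemma ev2_add: "ev2 p q (P + Q) = ev2 p q P + ev2 p q Q"
  unfolding ev2_def by (rule poly_subst_add) (simp_all add: scale_right_distrib ev_add)

lemma ev2_minus: "ev2 p q (- P) = - ev2 p q P"
  using ev2_add[of p q P "- P"] by (simp add: eq_neg_iff_add_eq_0 add.commute)

lemma ev2_diff: "ev2 p q (P - Q) = ev2 p q P - ev2 p q Q"
  using ev2_add[of p q P "- Q"] by (simp add: ev2_minus)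

lemma ev2_lam: "ev2 p q (lam2 P) = scale p (ev2 p q P)"
  by (simp add: ev2_pCons)

lemma ev2_mu: "ev2 p q (mu2 P) = scale q (ev2 p q P)"
  unfolding ev2_def
  by (rule poly_subst_map) (simp_all add: scale_right_distrib ev_pCons mult.commute)

lemma ev2_del: "ev2 p q (del2 scale P) = D (ev2 p q P)"
  unfolding ev2_def
  by (rule poly_subst_map) (simp_all add: scale_right_distrib ev_map_scale mult.commute)

lemma ev2_const: "ev2 p q (const2 v) = v"
  by (simp add: ev2_pCons ev_pCons)

lemma ev2_poly_subst:
  assumes "\<And>P Q. X (P + Q) = X P + X Q" "\<And>P. ev2 p q (X P) = scale r (ev2 p q P)" "e 0 = 0"
  shows "ev2 p q (poly_subst X e P) = poly_subst (scale r) (\<lambda>c. ev2 p q (e c)) P"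
  by (rule poly_subst_hom) (simp_all add: assms scale_right_distrib ev2_add)

lemma ev2_poly_subst_const:
  assumes "\<And>P Q. X (P + Q) = X P + X Q" "\<And>P. ev2 p q (X P) = scale r (ev2 p q P)"
  shows "ev2 p q (poly_subst X const2 P) = ev r P"
  by (subst ev2_poly_subst[OF assms]) (simp_all add: ev2_const ev_def)

end

section \<open>Conformal endomorphisms at a scalar\<close>

context H_module begin

lemma scale_linear: "scale [:a, 1:] v = D v + K a v" "scale [:a, - 1:] v = K a v - D v"
  by (simp_all only: scale_left_distrib[symmetric] scale_left_diff_distrib[symmetric]) simp_all

definition Cend_at :: "('v \<Rightarrow> 'v poly) \<Rightarrow> 'k \<Rightarrow> 'v \<Rightarrow> 'v" where
  "Cend_at f c v = ev [:c:] (f v)"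

lemma Cend_at_add:
  "f \<in> Cend scale \<Longrightarrow> Cend_at f c (v + w) = Cend_at f c v + Cend_at f c w"
  by (simp add: Cend_at_def CendD ev_add)

text \<open>
  Sesqui-linearity at \<open>\<lambda> = c\<close> reads \<open>f\<^sub>c \<partial> = (\<partial> + c) f\<^sub>c\<close>, so \<open>f\<^sub>c\<close> is semilinear over the shift
  \<open>\<partial> \<mapsto> \<partial> + c\<close> of \<open>H\<close>.
\<close>

lemma Cend_at_scale:
  assumes f: "f \<in> Cend scale"
  shows "Cend_at f c (scale p v) = scale (pcompose p [:c, 1:]) (Cend_at f c v)"
proof (induction p)
  case 0 then show ?case by (simp add: Cend_at_def CendD(4)[OF f])
next
  case (pCons a p)
  have D: "Cend_at f c (D w) = scale [:c, 1:] (Cend_at f c w)" for w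
    unfolding Cend_at_def CendD(3)[OF f] ev_add ev_map_scale ev_pCons scale_linear(1)[of c] by simp
  have K: "Cend_at f c (K a v) = K a (Cend_at f c v)"
    unfolding Cend_at_def CendD(2)[OF f] ev_map_scale ..
  show ?case
    unfolding scale_pCons[of a p v] Cend_at_add[OF f] K D pCons.IH pcompose_pCons scale_left_distrib
    by (simp only: scale_scale)
qed

lemma Cend_at_K: "f \<in> Cend scale \<Longrightarrow> Cend_at f c (K a v) = K a (Cend_at f c v)"
  by (simp add: Cend_at_scale)

lemma Cend_at_plus: "Cend_at (f + g) c v = Cend_at f c v + Cend_at g c v"
  by (simp add: Cend_at_def ev_add)

lemma Cend_at_zero: "Cend_at 0 c v = 0"
  by (simp add: Cend_at_def)

lemma Cend_at_Cend_scale: "Cend_at (Cend_scale scale p f) c v = K (poly p (- c)) (Cend_at f c v)"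
proof (induction p)
  case 0 then show ?case by (simp add: Cend_at_def Cend_scale_0)
next
  case (pCons a p)
  have "Cend_at (Cend_scale scale (pCons a p) f) c v = K a (Cend_at f c v) - K c (Cend_at (Cend_scale scale p f) c v)"
    by (simp only: Cend_at_def Cend_scale_pCons ev_diff ev_map_scale ev_pCons add_0)
  also have "\<dots> = K (poly (pCons a p) (- c)) (Cend_at f c v)"
    unfolding pCons.IH scale_scale scale_left_diff_distrib[symmetric] by (simp add: mult.commute)
  finally show ?case .
qed

lemma ev2_eq_sum:
  assumes "degree Q \<le> N"
  shows "ev2 [:c:] q Q = (\<Sum>n\<le>N. K (c ^ n) (ev q (coeff Q n)))"
  unfolding ev2_def by (subst poly_subst_eq_sum[OF _ _ assms]) (simp_all add: funpow_K)

text \<open>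
  This is \<open>(f\<^sub>(\<^sub>\<lambda>\<^sub>) g)\<^sub>\<mu> = f\<^sub>\<lambda> \<circ> g\<^sub>\<mu>\<^sub>-\<^sub>\<lambda>\<close> at \<open>\<lambda> = a\<close>, \<open>\<mu> = b\<close>.
\<close>

lemma Cend_lprod_at:
  assumes f: "f \<in> Cend scale" and g: "g \<in> Cend scale" and S: "finite S" "span S = UNIV"
  shows "(\<Sum>n\<le>degree (Cend_lprod f g). K (a ^ n) (Cend_at (coeff (Cend_lprod f g) n) b v))
    = Cend_at f a (Cend_at g (b - a) v)"
proof -
  note C = coeff_Cend_lprod[OF f g S]
  have ev2_E: "ev2 [:a:] [:b:] (E P) = ev [:a:] P" for P
    unfolding E_def by (rule ev2_poly_subst_const) (simp_all only: lam_add ev2_lam)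
  have "degree (Cend_eval f g v) \<le> degree (Cend_lprod f g)"
  proof (rule degree_le, intro allI impI)
    fix n assume "degree (Cend_lprod f g) < n"
    then have "coeff (Cend_lprod f g) n = 0" by (rule coeff_eq_0)
    then show "coeff (Cend_eval f g v) n = 0" using C[of n v] by simp
  qed
  then have "(\<Sum>n\<le>degree (Cend_lprod f g). K (a ^ n) (Cend_at (coeff (Cend_lprod f g) n) b v))
     = ev2 [:a:] [:b:] (Cend_eval f g v)"
    by (simp add: ev2_eq_sum Cend_at_def C)
  also have "\<dots> = poly_subst (scale [:b - a:]) (\<lambda>w. Cend_at f a w) (g v)"
    unfolding Cend_evalE
    by (subst ev2_poly_subst[where r = "[:b - a:]", OF T_add])
      (simp_all only: CendD(4)[OF f] E_0 minus_apply ev2_diff ev2_mu ev2_lam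
        scale_left_diff_distrib[symmetric] diff_pCons diff_zero ev2_E Cend_at_def[abs_def])
  also have "\<dots> = Cend_at f a (Cend_at g (b - a) v)"
    unfolding Cend_at_def[of g]
    by (rule ev_poly_subst[symmetric]) (simp_all add: Cend_at_add[OF f] Cend_at_K[OF f])
  finally show ?thesis .
qed

end

section \<open>The Novikov axioms as operator identities\<close>

locale novikov_operators = novikov_conformal_algebra scale UNIV circ
  for scale :: "'k::field_char_0 poly \<Rightarrow> 'v::ab_group_add \<Rightarrow> 'v" and circ
begin

sublocale H_module scale ..

lemma left_mult_Cend: "circ a \<in> Cend scale"
  by (simp add: Cend_def lprod_add_right lprod_scale_right lprod_del_right)

lemma right_mult_Cend: "right_mult scale circ a \<in> Cend scale"
  by (rule right_mult_in_Cend) unfold_locales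

abbreviation "L a \<equiv> Cend_at (circ a)"
abbreviation "R a \<equiv> Cend_at (right_mult scale circ a)"

lemmas L_add = Cend_at_add[OF left_mult_Cend]
lemmas L_K = Cend_at_K[OF left_mult_Cend]
lemmas L_scale = Cend_at_scale[OF left_mult_Cend]
lemmas R_add = Cend_at_add[OF right_mult_Cend]
lemmas R_K = Cend_at_K[OF right_mult_Cend]
lemmas R_scale = Cend_at_scale[OF right_mult_Cend]

lemma L_add_left: "L (a + b) c v = L a c v + L b c v"
  by (simp add: Cend_at_def lprod_add_left ev_add)

lemma circ_0: "circ 0 b = 0" "circ a 0 = 0"
  using lprod_add_left[of 0 0 b] lprod_add_right[of a 0 0] by simp_all

lemma L_scale_left: "L (scale p a) c v = K (poly p (- c)) (L a c v)"
proof (induction p)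
  case 0 then show ?case by (simp add: Cend_at_def circ_0)
next
  case (pCons b p)
  have K: "L (K b a) c v = K b (L a c v)"
    by (simp only: Cend_at_def lprod_scale_left[OF UNIV_I UNIV_I] ev_map_scale)
  have D: "L (D w) c v = - K c (L w c v)" for w
    by (simp only: Cend_at_def lprod_del_left[OF UNIV_I UNIV_I] ev_minus ev_pCons add_0)
  have "L (scale (pCons b p) a) c v = K b (L a c v) - K c (K (poly p (- c)) (L a c v))"
    unfolding scale_pCons[of b p a] L_add_left K D pCons.IH by simp
  also have "\<dots> = K (poly (pCons b p) (- c)) (L a c v)"
    unfolding scale_scale scale_left_diff_distrib[symmetric] by (simp add: mult.commute)
  finally show ?case .
qed

text \<open>
  \<open>R\<^sup>a\<^sub>c v = v \<circ>\<^sub>\<lambda> a\<close> at \<open>\<lambda> = - c - \<partial>\<close>, the polynomial \<open>[:- c, - 1:]\<close> of \<open>H\<close>.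
\<close>

lemma R_eq: "R a c v = ev [:- c, - 1:] (circ v a)"
proof -
  have "R a c v = poly_subst (scale [:- c, - 1:]) (\<lambda>u. ev [:c:] [:u:]) (circ v a)"
    unfolding Cend_at_def right_mult_def lbrace_def
  proof (rule poly_subst_hom)
    show "ev [:c:] ((- map_poly D - pCons 0) P) = scale [:- c, - 1:] (ev [:c:] P)" for P
      using scale_minus_left[of "[:c:]"] by (simp add: ev_diff ev_minus ev_map_scale ev_pCons scale_linear(2)[of "- c"])
  qed (simp_all add: map_scale_add scale_right_distrib ev_add)
  then show ?thesis by (simp only: ev_pCons ev_0 scale_zero_right add_0_right ev_def[of "[:- c, - 1:]", symmetric])
qed

lemma R_plus: "R (a + b) c v = R a c v + R b c v"
  by (simp add: R_eq lprod_add_right ev_add)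

lemma R_scale_param: "R (K b a) c v = K b (R a c v)"
  by (simp only: R_eq lprod_scale_right[OF UNIV_I UNIV_I] ev_map_scale)

lemma ev2_lprod_left:
  assumes "\<And>P Q. X (P + Q) = X P + X Q" "\<And>P. ev2 p q (X P) = scale x (ev2 p q P)"
    and "\<And>P Q. Y (P + Q) = Y P + Y Q" "\<And>P. ev2 p q (Y P) = scale y (ev2 p q P)"
  shows "ev2 p q (lprod_left circ X Y a b c) = poly_subst (scale x) (\<lambda>u. ev y (circ u c)) (circ a b)"
  unfolding lprod_left_def
  by (subst ev2_poly_subst[OF assms(1,2)])
    (simp_all add: circ_0 poly_subst_0 ev2_poly_subst_const[OF assms(3,4)])

lemma ev2_lprod_right:
  assumes "\<And>P Q. X (P + Q) = X P + X Q" "\<And>P. ev2 p q (X P) = scale x (ev2 p q P)"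
    and "\<And>P Q. Y (P + Q) = Y P + Y Q" "\<And>P. ev2 p q (Y P) = scale y (ev2 p q P)"
  shows "ev2 p q (lprod_right circ X Y a b c) = poly_subst (scale y) (\<lambda>u. ev x (circ a u)) (circ b c)"
  unfolding lprod_right_def
  by (subst ev2_poly_subst[OF assms(3,4)])
    (simp_all add: circ_0 poly_subst_0 ev2_poly_subst_const[OF assms(1,2)])

text \<open>
  The second Novikov axiom at \<open>\<lambda> = p(\<partial>)\<close>, \<open>\<mu> = q(\<partial>)\<close>.
\<close>

lemma right_commutative_at:
  "poly_subst (scale p) (\<lambda>u. ev q (circ u c)) (circ a b)
    = poly_subst (scale p) (\<lambda>u. ev ([:0, - 1:] - (q - p)) (circ u b)) (circ a c)"
proof -
  let ?Y = "- del2 scale - (mu2 - lam2)"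
  have Y: "ev2 p q (?Y P) = scale ([:0, - 1:] - (q - p)) (ev2 p q P)" for P
    by (simp add: ev2_diff ev2_minus ev2_mu ev2_lam ev2_del scale_left_diff_distrib scale_linear(2)[of 0] del: diff_pCons)
  have "ev2 p q (lprod_left circ lam2 mu2 a b c) = poly_subst (scale p) (\<lambda>u. ev q (circ u c)) (circ a b)"
    by (rule ev2_lprod_left) (simp_all only: lam_add mu2_add ev2_lam ev2_mu)
  moreover have "ev2 p q (lprod_left circ lam2 ?Y a c b)
      = poly_subst (scale p) (\<lambda>u. ev ([:0, - 1:] - (q - p)) (circ u b)) (circ a c)"
    by (rule ev2_lprod_left) (simp_all only: lam_add ev2_lam Y, simp add: map2_add mu2_add)
  ultimately show ?thesis using right_commutative[of a b c] by simp
qed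

lemma R_commute: "R c n (R b k a) = R b k (R c n a)"
proof -
  have nk: "- k - n = - n - k" by simp
  \<comment> \<open>\<open>R c n (R b k a)\<close> is \<open>(a\<^sub>\<lambda> b)\<^sub>\<mu> c\<close> with \<open>\<mu> = - \<partial> - n\<close> and, as \<open>R c n\<close> shifts \<open>\<partial>\<close> by \<open>n\<close>, \<open>\<lambda> = - \<partial> - n - k\<close>.\<close>
  have "R c n (R b k a) = poly_subst (scale [:- n - k, - 1:]) (\<lambda>u. R c n u) (circ a b)"
    unfolding R_eq[of b]
    by (rule ev_poly_subst) (simp_all add: R_add R_scale pcompose_pCons nk)
  also have "\<dots> = poly_subst (scale [:- n - k, - 1:]) (\<lambda>u. R b k u) (circ a c)"
    unfolding R_eq by (subst right_commutative_at) simp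
  also have "\<dots> = R b k (R c n a)"
    unfolding R_eq[of c]
    by (rule ev_poly_subst[symmetric]) (simp_all add: R_add R_scale pcompose_pCons nk)
  finally show ?thesis .
qed

lemma L_L: "L (L a l b) m c = R b (m - l) (L a l c)"
proof -
  have "L (L a l b) m c = poly_subst (scale [:l:]) (\<lambda>u. L u m c) (circ a b)"
    unfolding Cend_at_def[of "circ a"]
    by (rule ev_poly_subst) (simp_all add: L_add_left L_scale_left)
  also have "\<dots> = poly_subst (scale [:l:]) (\<lambda>u. R b (m - l) u) (circ a c)"
    unfolding R_eq Cend_at_def[of "circ _"] by (subst right_commutative_at) (simp add: algebra_simps)
  also have "\<dots> = R b (m - l) (L a l c)"
    unfolding Cend_at_def[of "circ a"]
    by (rule ev_poly_subst[symmetric]) (simp_all add: R_add R_scale)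
  finally show ?thesis .
qed

text \<open>
  Both sides are \<open>(a\<^sub>\<lambda> b)\<^sub>m c\<close> at \<open>\<lambda> = m - k\<close>, by \<open>L_L\<close> for the right one. Consequently the image of an
  operator made of right multiplications is closed under multiplication by \<open>V\<close> from the right.
\<close>

lemma L_R: "L (R b k a) m c = R b k (L a (m - k) c)"
proof -
  have "L (R b k a) m c = poly_subst (scale [:m - k:]) (\<lambda>u. L u m c) (circ a b)"
    unfolding R_eq by (rule ev_poly_subst) (simp_all add: L_add_left L_scale_left)
  also have "\<dots> = L (L a (m - k) b) m c"
    unfolding Cend_at_def[of "circ a"]
    by (rule ev_poly_subst[symmetric]) (simp_all add: L_add_left L_scale_left)
  finally show ?thesis by (simp add: L_L)
qed

text \<open>
  The first Novikov axiom for \<open>a, b, c\<close> at \<open>\<lambda> = l\<close>, \<open>\<mu> = - \<partial> - l - n\<close>; the value of \<open>\<mu>\<close> is chosen such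
  that \<open>\<lambda> + \<mu> = - \<partial> - n\<close>, which makes the outer products by \<open>c\<close> equal to \<open>R c n\<close>.
\<close>

lemma L_R_commutator:
  "L a l (R c n b) - R c n (L a l b) = R (L a l c) (l + n) b - R c n (R a l b)"
proof -
  let ?p = "[:l:]" and ?q = "[:- l - n, - 1:]"
  have sum: "ev2 ?p ?q ((lam2 + mu2) P) = scale [:- n, - 1:] (ev2 ?p ?q P)" for P
    unfolding plus_fun_apply ev2_add ev2_lam ev2_mu scale_left_distrib[symmetric] by simp
  have 1: "ev2 ?p ?q (lprod_left circ lam2 (lam2 + mu2) a b c) = R c n (L a l b)"
  proof -
    have "ev2 ?p ?q (lprod_left circ lam2 (lam2 + mu2) a b c) = poly_subst (scale ?p) (\<lambda>u. ev [:- n, - 1:] (circ u c)) (circ a b)"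
      by (rule ev2_lprod_left) (simp_all only: lam_add ev2_lam sum, simp add: mu2_add)
    also have "\<dots> = R c n (L a l b)"
      unfolding R_eq[symmetric] Cend_at_def[of "circ a"]
      by (rule ev_poly_subst[symmetric]) (simp_all add: R_add R_scale)
    finally show ?thesis .
  qed
  have 2: "ev2 ?p ?q (lprod_right circ lam2 mu2 a b c) = L a l (R c n b)"
  proof -
    have "ev2 ?p ?q (lprod_right circ lam2 mu2 a b c) = poly_subst (scale ?q) (\<lambda>u. ev ?p (circ a u)) (circ b c)"
      by (rule ev2_lprod_right) (simp_all only: lam_add mu2_add ev2_lam ev2_mu)
    also have "\<dots> = L a l (R c n b)"
      unfolding R_eq Cend_at_def[symmetric]
      by (rule ev_poly_subst[symmetric]) (simp_all add: L_add L_scale pcompose_pCons algebra_simps)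
    finally show ?thesis .
  qed
  have 3: "ev2 ?p ?q (lprod_left circ mu2 (lam2 + mu2) b a c) = R c n (R a l b)"
  proof -
    have "ev2 ?p ?q (lprod_left circ mu2 (lam2 + mu2) b a c) = poly_subst (scale ?q) (\<lambda>u. ev [:- n, - 1:] (circ u c)) (circ b a)"
      by (rule ev2_lprod_left) (simp_all only: mu2_add ev2_mu sum, simp add: mu2_add)
    also have "\<dots> = R c n (R a l b)"
      unfolding R_eq[of c, symmetric] R_eq[of a]
      by (rule ev_poly_subst[symmetric]) (simp_all add: R_add R_scale pcompose_pCons algebra_simps)
    finally show ?thesis .
  qed
  have 4: "ev2 ?p ?q (lprod_right circ mu2 lam2 b a c) = R (L a l c) (l + n) b"
  proof -
    have "ev2 ?p ?q (lprod_right circ mu2 lam2 b a c) = poly_subst (scale ?p) (\<lambda>u. ev ?q (circ b u)) (circ a c)"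
      by (rule ev2_lprod_right) (simp_all only: lam_add mu2_add ev2_lam ev2_mu)
    also have "\<dots> = poly_subst (scale ?p) (\<lambda>u. R u (l + n) b) (circ a c)"
      unfolding R_eq by simp
    also have "\<dots> = R (L a l c) (l + n) b"
      unfolding Cend_at_def[of "circ a"]
      by (rule ev_poly_subst[symmetric]) (simp_all add: R_plus R_scale_param)
    finally show ?thesis .
  qed
  have "ev2 ?p ?q (lprod_left circ lam2 (lam2 + mu2) a b c) - ev2 ?p ?q (lprod_right circ lam2 mu2 a b c)
      = ev2 ?p ?q (lprod_left circ mu2 (lam2 + mu2) b a c) - ev2 ?p ?q (lprod_right circ mu2 lam2 b a c)"
    unfolding ev2_diff[symmetric] left_symmetric[OF UNIV_I UNIV_I UNIV_I, of a b c] ..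
  then show ?thesis unfolding 1 2 3 4 by (simp add: algebra_simps)
qed

end

section \<open>Ideals and the derived series\<close>

context H_module begin

interpretation K: module "\<lambda>c. K c" by (rule module_K)

lemma K_subspace: "subspace U \<Longrightarrow> K.subspace U"
  by (simp add: subspace_def K.subspace_def)

lemma zero_in_derived: "subspace I \<Longrightarrow> 0 \<in> conformal_derived scale lprod I n"
  by (cases n) (simp_all add: subspace_0 K.span_zero)

lemma coeff_in_derived_Suc:
  "x \<in> conformal_derived scale lprod I n \<Longrightarrow> y \<in> conformal_derived scale lprod I n \<Longrightarrow>
    coeff (lprod x y) m \<in> conformal_derived scale lprod I (Suc n)"
  by (auto intro: K.span_base)

lemma derived_subset_ideal:
  assumes I: "conformal_ideal scale C lprod I"
  shows "conformal_derived scale lprod I n \<subseteq> I"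
proof (induction n)
  case (Suc n)
  have "K.subspace I" "I \<subseteq> C" "\<And>x y m. x \<in> I \<Longrightarrow> y \<in> C \<Longrightarrow> coeff (lprod x y) m \<in> I"
    using I by (auto simp: conformal_ideal_def K_subspace)
  with Suc show ?case
    unfolding conformal_derived.simps by (intro K.span_minimal) blast+
qed simp

end

context simple_conformal_algebra begin

sublocale H_module scale ..

interpretation K: module "\<lambda>c. K c" by (rule module_K)

text \<open>
  The derived subspace of the carrier is closed under \<open>\<partial>\<close>, because
  \<open>\<partial> (x\<^sub>\<lambda> y) = x\<^sub>\<lambda> (\<partial> y) - \<lambda> (x\<^sub>\<lambda> y)\<close>. So it is a nonzero ideal, and simplicity makes it everything.
\<close>

lemma derived_carrier: "conformal_derived scale lprod C n = C"
proof -
  let ?P = "conformal_derived scale lprod C (Suc 0)"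
  have C: "subspace C" by (rule subspace_carrier)
  have sub: "?P \<subseteq> C"
    unfolding conformal_derived.simps
    using K_subspace[OF C] coeff_lprod_closed by (intro K.span_minimal) blast+
  have "D u \<in> ?P" if "u \<in> ?P" for u
    using that unfolding conformal_derived.simps
  proof (induction rule: K.span_induct_alt)
    case base then show ?case by (simp add: K.span_zero)
  next
    case (step c u v)
    then obtain x y m where u: "u = coeff (lprod x y) m" and xy: "x \<in> C" "y \<in> C" by auto
    have "D u = coeff (lprod x (D y)) m - coeff (pCons 0 (lprod x y)) m"
      using xy by (simp add: u lprod_del_right coeff_map_poly)
    moreover have P: "coeff (lprod x y) m \<in> ?P" if "y \<in> C" for y m
      using xy that by (intro coeff_in_derived_Suc) simp_all
    then have "coeff (lprod x (D y)) m \<in> ?P" "coeff (pCons 0 (lprod x y)) m \<in> ?P"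
      using xy subspace_scale[OF C] zero_in_derived[OF C, of lprod "Suc 0"]
      by (auto simp: coeff_pCons simp del: conformal_derived.simps split: nat.split)
    ultimately have "D u \<in> ?P" by (simp add: K.span_diff)
    then show ?case
      using step(2) by (simp add: scale_right_distrib DK K.span_add K.span_scale del: scale_scale)
  qed
  then have "subspace ?P"
    by (intro subspace_if_K_D) simp_all
  then have "conformal_ideal scale C lprod ?P"
    using sub by (auto simp: conformal_ideal_def intro: K.span_base)
  then have "?P = {0} \<or> ?P = C" by (rule ideal_trivial)
  moreover have "?P \<noteq> {0}"
  proof
    assume "?P = {0}"
    then have "coeff (lprod x y) m = 0" if "x \<in> C" "y \<in> C" for x y m
      using that coeff_in_derived_Suc[of x lprod C 0 y m] by auto
    then show False using lprod_nonzero by (metis poly_eqI coeff_0)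
  qed
  ultimately have P: "?P = C" by blast
  show ?thesis
  proof (induction n)
    case (Suc n)
    then show ?case using P by simp
  qed simp
qed

lemma semisimple: "semisimple_conformal_algebra scale C lprod"
proof
  fix I assume I: "conformal_ideal scale C lprod I" "conformal_solvable scale lprod I"
  show "I = {0}"
  proof (rule ccontr)
    assume "I \<noteq> {0}"
    then have "I = C" using ideal_trivial[OF I(1)] by blast
    then have "C = {0}" using I(2) derived_carrier by (auto simp: conformal_solvable_def)
    then show False
      using lprod_nonzero lprod_add_left[of 0 0 0] by auto
  qed
qed

end

section \<open>Rank of a finitely generated module\<close>

text \<open>
  A homogeneous linear system over a domain with more unknowns than equations has a nonzero
  solution. Eliminate one equation by means of a pivot, cross-multiplying because the pivot need not
  be invertible.
\<close>

lemma homogeneous_system_solution: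
  fixes A :: "'i \<Rightarrow> 'j \<Rightarrow> 'r::idom"
  assumes "finite J" "finite I" "card J < card I"
  shows "\<exists>p. (\<exists>i\<in>I. p i \<noteq> 0) \<and> (\<forall>j\<in>J. (\<Sum>i\<in>I. p i * A i j) = 0)"
  using assms
proof (induction J arbitrary: I A rule: finite_induct)
  case empty
  then have "I \<noteq> {}" by auto
  then show ?case by (intro exI[of _ "\<lambda>_. 1"]) auto
next
  case (insert k J)
  show ?case
  proof (cases "\<forall>i\<in>I. A i k = 0")
    case True
    then show ?thesis using insert.IH[of I A] insert.prems insert.hyps by auto
  next
    case False
    then obtain i0 where i0: "i0 \<in> I" "A i0 k \<noteq> 0" by auto
    let ?I = "I - {i0}"
    define B where "B i j = A i0 k * A i j - A i k * A i0 j" for i j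
    have "card J < card ?I" using insert.prems insert.hyps i0 by simp
    then obtain p where p: "\<exists>i\<in>?I. p i \<noteq> 0" "\<And>j. j \<in> J \<Longrightarrow> (\<Sum>i\<in>?I. p i * B i j) = 0"
      using insert.IH[of ?I B] insert.prems(1) by blast
    have Bk: "(\<Sum>i\<in>?I. p i * B i k) = 0" by (simp add: B_def)
    \<comment> \<open>The value at \<open>i0\<close> is the one that satisfies equation \<open>k\<close> after clearing the denominator \<open>A i0 k\<close>.\<close>
    define q where "q i = (if i = i0 then - (\<Sum>i\<in>?I. p i * A i k) else A i0 k * p i)" for i
    have "(\<Sum>i\<in>I. q i * A i j) = (\<Sum>i\<in>?I. p i * B i j)" for j
    proof -
      have "(\<Sum>i\<in>I. q i * A i j) = q i0 * A i0 j + (\<Sum>i\<in>?I. q i * A i j)"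
        using i0(1) insert.prems(1) by (simp add: sum.remove)
      also have "(\<Sum>i\<in>?I. q i * A i j) = (\<Sum>i\<in>?I. A i0 k * p i * A i j)"
        by (rule sum.cong) (auto simp: q_def)
      also have "q i0 * A i0 j = - (\<Sum>i\<in>?I. p i * A i k * A i0 j)"
        by (simp add: q_def sum_distrib_right)
      finally show ?thesis
        by (simp add: B_def sum_subtractf[symmetric] right_diff_distrib mult_ac)
    qed
    moreover have "\<exists>i\<in>I. q i \<noteq> 0" using p(1) i0(2) by (auto simp: q_def)
    ultimately show ?thesis using p(2) Bk by (intro exI[of _ q]) auto
  qed
qed

context H_module begin

definition H_independent :: "nat \<Rightarrow> (nat \<Rightarrow> 'v) \<Rightarrow> bool" where
  "H_independent m u \<longleftrightarrow> (\<forall>p. (\<Sum>i<m. scale (p i) (u i)) = 0 \<longrightarrow> (\<forall>i<m. p i = 0))"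

lemma H_independent_le_card:
  assumes S: "finite S" "span S = UNIV" and u: "H_independent m u"
  shows "m \<le> card S"
proof (rule ccontr)
  assume "\<not> m \<le> card S"
  have "\<exists>a. u i = (\<Sum>s\<in>S. scale (a s) s)" for i
  proof -
    have "u i \<in> range (\<lambda>a. \<Sum>s\<in>S. scale (a s) s)" using S by (simp add: span_finite[symmetric])
    then show ?thesis by auto
  qed
  then have "\<exists>a. \<forall>i. u i = (\<Sum>s\<in>S. scale (a i s) s)" by (intro choice) blast
  then obtain a where a: "\<And>i. u i = (\<Sum>s\<in>S. scale (a i s) s)" by blast
  obtain p where p: "\<exists>i\<in>{..<m}. p i \<noteq> 0" "\<And>s. s \<in> S \<Longrightarrow> (\<Sum>i<m. p i * a i s) = 0"
    using homogeneous_system_solution[OF S(1), of "{..<m}" a] \<open>\<not> m \<le> card S\<close> by auto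
  have "(\<Sum>i<m. scale (p i) (u i)) = (\<Sum>s\<in>S. scale (\<Sum>i<m. p i * a i s) s)"
    unfolding a scale_sum_right scale_sum_left by (subst sum.swap) simp
  also have "\<dots> = 0" using p(2) by simp
  finally show False using u p(1) by (auto simp: H_independent_def)
qed

end

section \<open>The graded algebra of right multiplications\<close>

context novikov_operators begin

interpretation K: module "\<lambda>c. K c" by (rule module_K)

lemma coeff_in_subspace_if_ev:
  assumes U: "K.subspace U" and F: "finite F" and val: "\<And>c. c \<notin> F \<Longrightarrow> ev [:c:] P \<in> U"
  shows "coeff P n \<in> U"
proof (cases "n \<le> degree P")
  case True
  have "finite {s. (2::'k) ^ s \<in> F}"
    using finite_vimageI[OF F inj_power_two] by (simp add: vimage_def)
  then obtain t where t: "\<And>s. (2::'k) ^ s \<in> F \<Longrightarrow> s < t"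
    by (auto simp: finite_nat_set_iff_bounded)
  \<comment> \<open>The powers of two from \<open>2\<^sup>t\<close> on avoid the exceptional set and are closed under doubling.\<close>
  let ?A = "{(2::'k) ^ s | s. t \<le> s}"
  have "\<exists>s'. 2 * 2 ^ s = (2::'k) ^ s' \<and> t \<le> s'" if "t \<le> s" for s
    using that by (intro exI[of _ "Suc s"]) simp
  then have A: "2 ^ t \<in> ?A" "0 \<notin> ?A" "\<And>x. x \<in> ?A \<Longrightarrow> 2 * x \<in> ?A"
    by auto
  have "(\<Sum>n\<le>degree P. K (x ^ n) (coeff P n)) \<in> U" if "x \<in> ?A" for x
  proof -
    have "x \<notin> F" using that t by force
    then show ?thesis using val[of x] by (simp add: ev_eq_sum[OF order_refl])
  qed
  from poly_values_in_subspace[where c = "coeff P", OF module_K U A this True] show ?thesis .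
next
  case False
  then show ?thesis using K.subspace_0[OF U] by (simp add: coeff_eq_0)
qed

lemma coeff_circ_in_subspace:
  assumes "K.subspace U" "finite F" "\<And>c. c \<notin> F \<Longrightarrow> L a c b \<in> U"
  shows "coeff (circ a b) n \<in> U"
  using coeff_in_subspace_if_ev[OF assms(1,2)] assms(3) by (simp add: Cend_at_def)

text \<open>
  The operators of degree \<open>c\<close> in the unital algebra generated by all \<open>R a d\<close>, each \<open>R a d\<close> having
  degree \<open>d\<close>. An operator of degree \<open>c\<close> is semilinear over the shift by \<open>c\<close>; sums are formed within
  one degree only, since otherwise semilinearity would be lost.
\<close>

inductive opalg :: "'k \<Rightarrow> ('v \<Rightarrow> 'v) \<Rightarrow> bool" where
  ident: "opalg 0 (\<lambda>v. v)"
| right: "opalg c (R a c)"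
| add: "opalg c x \<Longrightarrow> opalg c y \<Longrightarrow> opalg c (\<lambda>v. x v + y v)"
| scalar: "opalg c x \<Longrightarrow> opalg c (\<lambda>v. K b (x v))"
| comp: "opalg c x \<Longrightarrow> opalg d y \<Longrightarrow> opalg (c + d) (\<lambda>v. x (y v))"

lemma opalg_plus: "opalg c x \<Longrightarrow> x (v + w) = x v + x w"
  by (induction arbitrary: v w rule: opalg.induct) (simp_all add: R_add scale_right_distrib)

lemma opalg_scale: "opalg c x \<Longrightarrow> x (scale p v) = scale (pcompose p [:c, 1:]) (x v)"
proof (induction arbitrary: p v rule: opalg.induct)
  case (comp c x d y)
  have "pcompose [:d, 1:] [:c, 1:] = [:c + d, 1:]" by (simp add: pcompose_pCons)
  then have "pcompose (pcompose p [:d, 1:]) [:c, 1:] = pcompose p [:c + d, 1:]"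
    by (simp only: pcompose_assoc[symmetric])
  then show ?case by (simp only: comp.IH)
qed (simp_all add: R_scale scale_right_distrib mult.commute)

lemma opalg_K: "opalg c x \<Longrightarrow> x (K b v) = K b (x v)"
  by (simp add: opalg_scale)

lemma opalg_zero: "opalg c x \<Longrightarrow> x 0 = 0"
  using opalg_plus[of c x 0 0] by simp

lemma opalg_uminus: "opalg c x \<Longrightarrow> x (- v) = - x v"
  using opalg_plus[of c x v "- v"] by (simp add: opalg_zero eq_neg_iff_add_eq_0 add.commute)

lemma opalg_diff: "opalg c x \<Longrightarrow> x (v - w) = x v - x w"
  using opalg_plus[of c x v "- w"] by (simp add: opalg_uminus)

lemma opalg_sum: "opalg c x \<Longrightarrow> x (sum f A) = (\<Sum>i\<in>A. x (f i))"
  by (induction A rule: infinite_finite_induct) (simp_all add: opalg_zero opalg_plus)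

lemma opalg_commute:
  assumes "opalg c x" "opalg d y"
  shows "x (y v) = y (x v)"
proof -
  have R: "x (R a d v) = R a d (x v)" for a d v
    using assms(1)
    by (induction arbitrary: v rule: opalg.induct) (simp_all add: R_commute R_add R_K)
  show ?thesis
    using assms(2)
    by (induction arbitrary: v rule: opalg.induct)
      (simp_all add: R opalg_plus[OF assms(1)] opalg_K[OF assms(1)])
qed

lemma opalg_subtract: "opalg c x \<Longrightarrow> opalg c y \<Longrightarrow> opalg c (\<lambda>v. x v - y v)"
  using opalg.add[OF _ opalg.scalar[of c y "- 1"]] scale_minus_left[of 1]
  by (simp add: one_pCons)

lemma opalg_null: "opalg c (\<lambda>v. 0)"
  using opalg_subtract[OF opalg.right opalg.right, of c 0 0] by simp

lemma opalg_power: "opalg c x \<Longrightarrow> opalg (of_nat n * c) (x ^^ n)"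
proof (induction n)
  case 0 then show ?case using opalg.ident by (simp add: id_def)
next
  case (Suc n)
  then show ?case using opalg.comp[of c x "of_nat n * c" "x ^^ n"] by (simp add: o_def algebra_simps)
qed

text \<open>
  The algebra is stable under the derivations \<open>[L a l, _]\<close>: this is \<open>L_R_commutator\<close> on generators
  and the Leibniz rule on products.
\<close>

lemma opalg_commutator: "opalg c x \<Longrightarrow> opalg (c + l) (\<lambda>v. L a l (x v) - x (L a l v))"
proof (induction rule: opalg.induct)
  case ident then show ?case by (simp add: opalg_null)
next
  case (right c b)
  have "opalg (c + l) (\<lambda>v. R (L a l b) (c + l) v - R b c (R a l v))"
    by (intro opalg_subtract opalg.right opalg.comp)
  then show ?case by (simp add: L_R_commutator add.commute)
next
  case (add c x y)
  then show ?case using opalg.add[OF add.IH] by (simp add: L_add algebra_simps)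
next
  case (scalar c x b)
  then show ?case using opalg.scalar[OF scalar.IH, of b] by (simp add: L_K scale_right_diff_distrib)
next
  case (comp c x d y)
  have "opalg (c + d + l) (\<lambda>v. (L a l (x (y v)) - x (L a l (y v))) + x (L a l (y v) - y (L a l v)))"
    using opalg.comp[OF comp.IH(1) comp.hyps(2)] opalg.comp[OF comp.hyps(1) comp.IH(2)]
    by (intro opalg.add) (simp_all add: ac_simps)
  then show ?case by (simp add: opalg_diff[OF comp.hyps(1)])
qed

lemma opalg_left: "opalg c x \<Longrightarrow> L (x v) m w = x (L v (m - c) w)"
  by (induction arbitrary: m v w rule: opalg.induct)
    (simp_all add: L_R L_add_left L_scale_left diff_diff_eq)

section \<open>Nilpotent operators and derivations\<close>

text \<open>
  Homogeneity makes these operators semilinear over a shift of \<open>H\<close>, so their images and kernels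
  are \<open>H\<close>-submodules and the rank can be used to bound their products.
\<close>

definition nil :: "('v \<Rightarrow> 'v) \<Rightarrow> bool" where
  "nil x \<longleftrightarrow> (\<exists>c. opalg c x) \<and> (\<exists>m. \<forall>v. (x ^^ m) v = 0)"

lemma derivation_power:
  assumes x: "opalg c x" and y: "opalg d y" and comm: "\<And>v. l (x v) = x (l v) + y v"
  shows "l ((x ^^ n) v) = (x ^^ n) (l v) + K (of_nat n) ((x ^^ (n - 1)) (y v))"
proof (induction n)
  case (Suc n)
  have "l ((x ^^ Suc n) v) = x ((x ^^ n) (l v)) + x (K (of_nat n) ((x ^^ (n - 1)) (y v))) + (x ^^ n) (y v)"
    by (simp add: comm Suc.IH opalg_plus[OF x] opalg_commute[OF y opalg_power[OF x]])
  also have "x (K (of_nat n) ((x ^^ (n - 1)) (y v))) = K (of_nat n) ((x ^^ n) (y v))"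
    by (cases n) (simp_all add: opalg_K[OF x] opalg_zero[OF x])
  finally show ?case
    using scale_left_distrib[of "[:of_nat n:]" "[:1:]" "(x ^^ n) (y v)"] by (simp add: s1 add_ac)
qed simp

text \<open>
  Let \<open>y = [L a l, x]\<close> and \<open>z = [L a l, y]\<close>; all of them commute with each other. If
  \<open>x\<^sup>j\<^sup>+\<^sup>1 y\<^sup>2\<^sup>i = 0\<close>, then applying the derivation and multiplying by \<open>y\<close> gives
  \<open>(j + 1) x\<^sup>j y\<^sup>2\<^sup>i\<^sup>+\<^sup>2 + 2 i x\<^sup>j\<^sup>+\<^sup>1 y\<^sup>2\<^sup>i z = 0\<close>, whose second term vanishes. So powers of \<open>x\<close> are traded for
  powers of \<open>y\<close>, until \<open>y\<^sup>2\<^sup>m = 0\<close>. Dividing by \<open>j + 1\<close> uses characteristic zero.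
\<close>

lemma nil_commutator:
  assumes "nil x"
  shows "nil (\<lambda>v. L a l (x v) - x (L a l v))"
proof -
  obtain c m where x: "opalg c x" and m: "\<And>v. (x ^^ m) v = 0" using assms by (auto simp: nil_def)
  define y where "y = (\<lambda>v. L a l (x v) - x (L a l v))"
  define z where "z = (\<lambda>v. L a l (y v) - y (L a l v))"
  obtain d where y: "opalg d y" using opalg_commutator[OF x] by (auto simp: y_def)
  obtain e where z: "opalg e z" using opalg_commutator[OF y] by (auto simp: z_def)
  note px = opalg_power[OF x] and py = opalg_power[OF y]
  have Lx: "L a l (x v) = x (L a l v) + y v" and Ly: "L a l (y v) = y (L a l v) + z v" for v
    by (simp_all add: y_def z_def)
  have L0: "L a l 0 = 0" using L_add[of a l 0 0] by simp
  have "i \<le> m \<Longrightarrow> (x ^^ (m - i)) ((y ^^ (2 * i)) v) = 0" for i v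
  proof (induction i arbitrary: v)
    case 0 then show ?case using m by simp
  next
    case (Suc i)
    define j where "j = m - Suc i"
    have IH: "(x ^^ Suc j) ((y ^^ (2 * i)) v) = 0" for v
      using Suc.IH Suc.prems by (simp add: j_def Suc_diff_Suc del: funpow.simps)
    let ?w = "(y ^^ (2 * i)) v"
    have "0 = L a l ((x ^^ Suc j) ?w)" by (simp add: IH L0 del: funpow.simps)
    also have "\<dots> = (x ^^ Suc j) (L a l ?w) + K (of_nat (Suc j)) ((x ^^ j) (y ?w))"
      by (subst derivation_power[OF x y Lx]) simp
    also have "L a l ?w = (y ^^ (2 * i)) (L a l v) + K (of_nat (2 * i)) ((y ^^ (2 * i - 1)) (z v))"
      by (rule derivation_power[OF y z Ly])
    also have "(x ^^ Suc j) \<dots> = K (of_nat (2 * i)) ((x ^^ Suc j) ((y ^^ (2 * i - 1)) (z v)))"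
      by (simp only: opalg_plus[OF px] opalg_K[OF px] IH add_0)
    finally have "0 = y (K (of_nat (2 * i)) ((x ^^ Suc j) ((y ^^ (2 * i - 1)) (z v)))
        + K (of_nat (Suc j)) ((x ^^ j) (y ?w)))"
      by (simp only: opalg_zero[OF y] flip:)
    also have "\<dots> = K (of_nat (2 * i)) (y ((x ^^ Suc j) ((y ^^ (2 * i - 1)) (z v))))
        + K (of_nat (Suc j)) (y ((x ^^ j) (y ?w)))"
      by (simp only: opalg_plus[OF y] opalg_K[OF y])
    also have "y ((x ^^ j) (y ?w)) = (x ^^ j) ((y ^^ (2 * Suc i)) v)"
      by (simp add: opalg_commute[OF y px])
    also have "K (of_nat (2 * i)) (y ((x ^^ Suc j) ((y ^^ (2 * i - 1)) (z v)))) = 0"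
    proof (cases i)
      case (Suc i')
      have "y ((x ^^ Suc j) ((y ^^ (2 * i - 1)) (z v))) = (x ^^ Suc j) ((y ^^ (2 * i)) (z v))"
        by (simp only: opalg_commute[OF y px]) (simp add: Suc)
      then show ?thesis by (simp only: IH scale_zero_right)
    qed simp
    finally have "K (of_nat (Suc j)) ((x ^^ j) ((y ^^ (2 * Suc i)) v)) = 0" by simp
    then have "K (inverse (of_nat (Suc j)) * of_nat (Suc j)) ((x ^^ j) ((y ^^ (2 * Suc i)) v)) = 0"
      by (simp only: K.scale_scale[symmetric] scale_zero_right)
    then show ?case by (simp add: j_def s1 del: of_nat_Suc)
  qed
  from this[of m] have "(y ^^ (2 * m)) v = 0" for v by simp
  then show ?thesis using y by (auto simp: nil_def y_def[symmetric])
qed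

end

section \<open>The torsion ideal\<close>

context novikov_operators begin

interpretation K: module "\<lambda>c. K c" by (rule module_K)

definition torsion :: "'v set" where
  "torsion = {v. \<exists>p. p \<noteq> 0 \<and> scale p v = 0}"

lemma subspace_torsion: "subspace torsion"
  unfolding subspace_def
proof (intro conjI ballI allI)
  show "0 \<in> torsion" by (auto simp: torsion_def intro: exI[of _ 1])
next
  fix x y assume "x \<in> torsion" "y \<in> torsion"
  then obtain p q where "p \<noteq> 0" "scale p x = 0" "q \<noteq> 0" "scale q y = 0" by (auto simp: torsion_def)
  then have "p * q \<noteq> 0" "scale (p * q) (x + y) = 0"
    by (simp_all add: scale_right_distrib scale_scale[symmetric] scale_left_commute[of p q] del: scale_scale)
  then show "x + y \<in> torsion" unfolding torsion_def by blast
next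
  fix r x assume "x \<in> torsion"
  then obtain p where "p \<noteq> 0" "scale p x = 0" by (auto simp: torsion_def)
  then have "scale p (scale r x) = 0" by (subst scale_left_commute) simp
  then show "scale r x \<in> torsion" using \<open>p \<noteq> 0\<close> by (auto simp: torsion_def)
qed

text \<open>
  \<open>p(\<partial>) t = 0\<close> implies \<open>p(- c) (t \<circ>\<^sub>c b) = 0\<close>, so \<open>t \<circ>\<^sub>c b\<close> vanishes for all \<open>c\<close> with \<open>p(- c) \<noteq> 0\<close>,
  which are all but finitely many.
\<close>

lemma circ_torsion_left:
  assumes "t \<in> torsion"
  shows "circ t b = 0"
proof (rule poly_eqI)
  fix n
  obtain p where p: "p \<noteq> 0" "scale p t = 0" using assms by (auto simp: torsion_def)
  have fin: "finite (uminus ` {c. poly p c = 0})" using poly_roots_finite[OF p(1)] by simp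
  have "L t c b \<in> {0}" if "c \<notin> uminus ` {c. poly p c = 0}" for c
  proof -
    have "poly p (- c) \<noteq> 0" using that by (metis (mono_tags) imageI mem_Collect_eq minus_minus)
    moreover have "K (poly p (- c)) (L t c b) = 0"
      using L_scale_left[of p t c b] p(2) by (simp add: Cend_at_def circ_0)
    then have "K (inverse (poly p (- c))) (K (poly p (- c)) (L t c b)) = 0" by simp
    ultimately show ?thesis by (simp add: s1)
  qed
  then have "coeff (circ t b) n \<in> {0}"
    by (rule coeff_circ_in_subspace[OF K.subspace_single_0 fin])
  then show "coeff (circ t b) n = coeff 0 n" by simp
qed

lemma torsion_ideal: "conformal_ideal scale UNIV circ torsion"
proof -
  have "coeff (circ a t) n \<in> torsion" if t: "t \<in> torsion" for a t n
  proof (rule coeff_circ_in_subspace[OF K_subspace[OF subspace_torsion] finite.emptyI])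
    fix c
    obtain p where p: "p \<noteq> 0" "scale p t = 0" using t by (auto simp: torsion_def)
    then have "scale (pcompose p [:c, 1:]) (L a c t) = 0"
      by (simp add: L_scale[symmetric]) (simp add: Cend_at_def circ_0)
    moreover have "pcompose p [:c, 1:] \<noteq> 0" using p(1) by (simp add: pcompose_eq_0_iff)
    ultimately show "L a c t \<in> torsion" by (auto simp: torsion_def)
  qed
  then show ?thesis
    using subspace_torsion subspace_0[OF subspace_torsion]
    by (auto simp: conformal_ideal_def circ_torsion_left)
qed

lemma torsion_solvable: "conformal_solvable scale circ torsion"
proof -
  have "conformal_derived scale circ torsion 1 \<subseteq> {0}"
    by (simp, intro K.span_minimal) (auto simp: circ_torsion_left)
  then have "conformal_derived scale circ torsion 1 = {0}"
    using zero_in_derived[OF subspace_torsion, of circ 1] by blast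
  then show ?thesis unfolding conformal_solvable_def by blast
qed

section \<open>Products of nilpotent operators\<close>

primrec nil_products :: "nat \<Rightarrow> ('v \<Rightarrow> 'v) set" where
  "nil_products 0 = {\<lambda>v. v}"
| "nil_products (Suc k) = {\<lambda>v. x (p v) | x p. nil x \<and> p \<in> nil_products k}"

lemma nil_products_opalg: "p \<in> nil_products k \<Longrightarrow> \<exists>c. opalg c p"
proof (induction k arbitrary: p)
  case 0 then show ?case using opalg.ident by auto
next
  case (Suc k)
  then show ?case using opalg.comp by (fastforce simp: nil_def)
qed

text \<open>
  The image of \<open>x p\<close> has smaller rank than the image of \<open>p\<close>: \<open>x\<close> commutes with \<open>p\<close>, so it acts on the
  image of \<open>p\<close> as a nilpotent operator and kills some \<open>p w \<noteq> 0\<close> there. Adding \<open>p w\<close> to preimages of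
  independent elements of the image of \<open>x p\<close> keeps independence, as one sees by applying \<open>x\<close>.
\<close>

lemma H_independent_preimage:
  assumes torsion_free: "torsion = {0}"
    and x: "nil x" and p: "opalg d p"
    and u: "H_independent m (\<lambda>i. x (p (u i)))" "0 < m"
  shows "\<exists>u'. H_independent (Suc m) (\<lambda>i. p (u' i))"
proof -
  obtain c k where xc: "opalg c x" and k: "\<And>v. (x ^^ k) v = 0" using x by (auto simp: nil_def)
  have "x (p (u 0)) \<noteq> 0"
  proof
    assume "x (p (u 0)) = 0"
    then have "(\<Sum>i<m. scale (if i = 0 then 1 else 0) (x (p (u i)))) = 0"
      by (intro sum.neutral) auto
    then have "\<forall>i<m. (if i = 0 then 1 else 0) = (0 :: 'k poly)"
      using u(1)[unfolded H_independent_def, rule_format, of "\<lambda>i. if i = 0 then 1 else 0"] by blast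
    then show False using u(2) by auto
  qed
  then have u0: "p (u 0) \<noteq> 0" using opalg_zero[OF xc] by auto
  define j where "j = (LEAST j. (x ^^ j) (p (u 0)) = 0)"
  have j: "(x ^^ j) (p (u 0)) = 0" unfolding j_def by (rule LeastI[of _ k]) (rule k)
  then obtain i where i: "j = Suc i" using u0 by (cases j) auto
  define w where "w = (x ^^ i) (u 0)"
  have pw: "p w = (x ^^ i) (p (u 0))"
    unfolding w_def by (rule opalg_commute[OF p opalg_power[OF xc]])
  have "p w \<noteq> 0"
    using not_less_Least[of i "\<lambda>j. (x ^^ j) (p (u 0)) = 0"] unfolding pw j_def[symmetric] i by simp
  have xpw: "x (p w) = 0" using j by (simp add: pw i)
  have "H_independent (Suc m) (\<lambda>i. p ((u(m := w)) i))"
    unfolding H_independent_def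
  proof (intro allI impI)
    fix q i assume q: "(\<Sum>i<Suc m. scale (q i) (p ((u(m := w)) i))) = 0" and i: "i < Suc m"
    have split: "(\<Sum>i<Suc m. scale (q i) (p ((u(m := w)) i))) = (\<Sum>i<m. scale (q i) (p (u i))) + scale (q m) (p w)"
      by simp
    have "0 = x (\<Sum>i<Suc m. scale (q i) (p ((u(m := w)) i)))"
      by (simp only: q opalg_zero[OF xc])
    also have "\<dots> = (\<Sum>i<m. scale (pcompose (q i) [:c, 1:]) (x (p (u i))))"
      by (simp only: split opalg_plus[OF xc] opalg_sum[OF xc] opalg_scale[OF xc] xpw scale_zero_right add_0_right)
    finally have "\<forall>i<m. pcompose (q i) [:c, 1:] = 0"
      using u(1)[unfolded H_independent_def, rule_format, of "\<lambda>i. pcompose (q i) [:c, 1:]"] by simp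
    then have low: "\<forall>i<m. q i = 0" by (simp add: pcompose_eq_0_iff)
    then have "scale (q m) (p w) = 0" using q by simp
    then have "q m = 0" using \<open>p w \<noteq> 0\<close> torsion_free by (auto simp: torsion_def)
    then show "q i = 0" using low i by (cases "i = m") auto
  qed
  then show ?thesis by blast
qed

lemma H_independent_nil_products:
  assumes torsion_free: "torsion = {0}"
  shows "p \<in> nil_products k \<Longrightarrow> H_independent m (\<lambda>i. p (u i)) \<Longrightarrow> 0 < m \<Longrightarrow> \<exists>u'. H_independent (k + m) u'"
proof (induction k arbitrary: p m u)
  case 0 then show ?case by auto
next
  case (Suc k)
  then obtain x p' where p: "p = (\<lambda>v. x (p' v))" "nil x" "p' \<in> nil_products k" by auto
  obtain d where "opalg d p'" using nil_products_opalg[OF p(3)] by blast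
  then obtain u' where "H_independent (Suc m) (\<lambda>i. p' (u' i))"
    using H_independent_preimage[OF torsion_free p(2)] Suc.prems(2,3) p(1) by blast
  then show ?case using Suc.IH[OF p(3), of "Suc m" u'] by simp
qed

text \<open>
  Every factor adds one to the rank that \<open>V\<close> must have, so a nonzero product of \<open>card S\<close> nilpotent
  operators would need rank at least \<open>card S + 1\<close>.
\<close>

lemma nil_products_vanish:
  assumes torsion_free: "torsion = {0}" and S: "finite S" "span S = UNIV"
    and p: "p \<in> nil_products (card S)"
  shows "p v = 0"
proof (rule ccontr)
  assume "p v \<noteq> 0"
  then have "H_independent 1 (\<lambda>i. p v)"
    using torsion_free by (auto simp: H_independent_def torsion_def)
  then have "\<exists>u'. H_independent (card S + 1) u'"
    using H_independent_nil_products[OF torsion_free p, of 1 "\<lambda>_. v"] by simp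
  then show False using H_independent_le_card[OF S] by force
qed

section \<open>The ideal spanned by the images of nilpotent operators\<close>

text \<open>
  The span is over the field. It is closed under \<open>\<partial>\<close> all the same, by semilinearity of the operators.
\<close>

definition nil_power_span :: "nat \<Rightarrow> 'v set" where
  "nil_power_span k = K.span {p v | p v. p \<in> nil_products k}"

abbreviation "nil_span \<equiv> nil_power_span (Suc 0)"

lemma nil_in_nil_span: "nil x \<Longrightarrow> x v \<in> nil_span"
  unfolding nil_power_span_def by (rule K.span_base) auto

lemma nil_span_induct [consumes 1, case_names zero add]:
  assumes "u \<in> nil_span" "P 0" "\<And>b x v w. nil x \<Longrightarrow> P w \<Longrightarrow> P (K b (x v) + w)"
  shows "P u"
  using assms(1) unfolding nil_power_span_def
  by (induction rule: K.span_induct_alt) (auto intro: assms(2,3))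

lemma subspace_nil_span: "subspace nil_span"
proof (rule subspace_if_K_D)
  show K: "K.subspace nil_span" by (simp add: nil_power_span_def)
  fix u assume "u \<in> nil_span"
  then show "D u \<in> nil_span"
  proof (induction rule: nil_span_induct)
    case zero then show ?case using K.subspace_0[OF K] by simp
  next
    case (add b x v w)
    then obtain c where x: "opalg c x" by (auto simp: nil_def)
    have "D (x v) = x (scale [:- c, 1:] v)" by (simp add: opalg_scale[OF x] pcompose_pCons)
    then have "D (K b (x v) + w) = K b (x (scale [:- c, 1:] v)) + D w"
      by (simp only: scale_right_distrib DK)
    then show ?case
      using add nil_in_nil_span by (simp only: K.subspace_add[OF K] K.subspace_scale[OF K])
  qed
qed

lemmas K_subspace_nil_span = K_subspace[OF subspace_nil_span]

lemma nil_span_ideal: "conformal_ideal scale UNIV circ nil_span"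
proof -
  have zero_mem: "0 \<in> nil_span" by (rule K.subspace_0[OF K_subspace_nil_span])
  have "coeff (circ a u) n \<in> nil_span" if "u \<in> nil_span" for a u n
  proof (rule coeff_circ_in_subspace[OF K_subspace_nil_span finite.emptyI])
    fix c show "L a c u \<in> nil_span"
      using that
    proof (induction rule: nil_span_induct)
      case zero then show ?case using zero_mem by (simp add: Cend_at_def circ_0)
    next
      case (add b x v w)
      \<comment> \<open>The bracket is the value at \<open>v\<close> of a commutator, which is again nilpotent.\<close>
      have "L a c (x v) = (L a c (x v) - x (L a c v)) + x (L a c v)" by simp
      also have "\<dots> \<in> nil_span"
        by (intro K.subspace_add[OF K_subspace_nil_span] nil_in_nil_span add(1)
            nil_in_nil_span[OF nil_commutator[OF add(1)]])
      finally show ?case using add by (simp add: L_add L_K K_subspace_nil_span K.subspace_add K.subspace_scale)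
    qed
  qed
  moreover have "coeff (circ u a) n \<in> nil_span" if "u \<in> nil_span" for a u n
  proof (rule coeff_circ_in_subspace[OF K_subspace_nil_span finite.emptyI])
    fix c show "L u c a \<in> nil_span"
      using that
    proof (induction rule: nil_span_induct)
      case zero then show ?case using zero_mem by (simp add: Cend_at_def circ_0)
    next
      case (add b x v w)
      obtain e where x: "opalg e x" using add by (auto simp: nil_def)
      show ?case
        using add nil_in_nil_span[OF add(1)]
        by (simp add: L_add_left L_scale_left opalg_left[OF x] K_subspace_nil_span K.subspace_add K.subspace_scale)
    qed
  qed
  ultimately show ?thesis by (simp add: conformal_ideal_def subspace_nil_span)
qed

text \<open>
  For a \<open>k\<close>-fold product \<open>p\<close> of nilpotents, \<open>(p v) \<circ>\<^sub>c u\<close> is \<open>p\<close> applied to some \<open>v \<circ>\<^sub>d u\<close>, by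
  \<open>opalg_left\<close>. If \<open>u\<close> lies in the ideal \<open>nil_span\<close>, then so does \<open>v \<circ>\<^sub>d u\<close>, and this provides one
  more nilpotent factor.
\<close>

lemma derived_nil_span: "conformal_derived scale circ nil_span n \<subseteq> nil_power_span (Suc n)"
proof (induction n)
  case (Suc n)
  have K: "K.subspace (nil_power_span k)" for k by (simp add: nil_power_span_def)
  have mult: "p w \<in> nil_power_span (Suc (Suc n))" if p: "p \<in> nil_products (Suc n)" and w: "w \<in> nil_span" for p w
    using w
  proof (induction rule: nil_span_induct)
    case zero then show ?case using nil_products_opalg[OF p] opalg_zero K.subspace_0[OF K] by force
  next
    case (add b x v w)
    obtain c where pc: "opalg c p" using nil_products_opalg[OF p] by blast
    obtain e where xe: "opalg e x" using add by (auto simp: nil_def)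
    have "(\<lambda>v. x (p v)) \<in> nil_products (Suc (Suc n))"
      using p add(1) by (subst nil_products.simps) blast
    then have "x (p v) \<in> nil_power_span (Suc (Suc n))"
      unfolding nil_power_span_def
      by (intro K.span_base CollectI exI[of _ "\<lambda>v. x (p v)"] exI[of _ v]) simp
    then show ?case
      using add by (simp add: opalg_plus[OF pc] opalg_K[OF pc] opalg_commute[OF pc xe] K.subspace_add[OF K] K.subspace_scale[OF K])
  qed
  have "coeff (circ u u') m \<in> nil_power_span (Suc (Suc n))"
    if "u \<in> nil_power_span (Suc n)" "u' \<in> nil_span" for u u' m
  proof (rule coeff_circ_in_subspace[OF K finite.emptyI])
    fix c
    show "L u c u' \<in> nil_power_span (Suc (Suc n))"
      using that(1) unfolding nil_power_span_def[of "Suc n"]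
    proof (induction rule: K.span_induct_alt)
      case base then show ?case using K.subspace_0[OF K] by (simp add: Cend_at_def circ_0)
    next
      case (step b y z)
      then obtain p v where y: "y = p v" and p: "p \<in> nil_products (Suc n)" by blast
      obtain e where pe: "opalg e p" using nil_products_opalg[OF p] by blast
      have "L v (c - e) u' \<in> nil_span"
      proof -
        have "coeff (circ v u') i \<in> nil_span" for i
          using nil_span_ideal that(2) by (auto simp: conformal_ideal_def)
        then show ?thesis
          unfolding Cend_at_def ev_eq_sum[OF order_refl]
          by (intro K.subspace_sum[OF K_subspace_nil_span] K.subspace_scale[OF K_subspace_nil_span])
      qed
      then have "L y c u' \<in> nil_power_span (Suc (Suc n))"
        unfolding y opalg_left[OF pe] by (rule mult[OF p])
      then show ?case
        using step by (simp add: L_add_left L_scale_left K.subspace_add[OF K] K.subspace_scale[OF K])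
    qed
  qed
  moreover have "conformal_derived scale circ nil_span n \<subseteq> nil_span"
    by (rule derived_subset_ideal[OF nil_span_ideal])
  ultimately show ?case
    using Suc K unfolding conformal_derived.simps by (intro K.span_minimal) blast+
qed simp

text \<open>
  Products with more factors than \<open>V\<close> has generators vanish, so the bound of \<open>derived_nil_span\<close>
  reaches \<open>0\<close>.
\<close>

lemma nil_span_solvable:
  assumes torsion_free: "torsion = {0}" and S: "finite S" "span S = UNIV"
  shows "conformal_solvable scale circ nil_span"
proof -
  have "p v = 0" if p: "p \<in> nil_products (Suc (card S))" for p v
  proof -
    obtain x q where p: "p = (\<lambda>v. x (q v))" and x: "nil x" and q: "q \<in> nil_products (card S)"
      using p by auto
    obtain c where "opalg c x" using x by (auto simp: nil_def)
    then show ?thesis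
      by (simp add: p nil_products_vanish[OF torsion_free S q] opalg_zero)
  qed
  then have "nil_power_span (Suc (card S)) \<subseteq> {0}"
    unfolding nil_power_span_def by (intro K.span_minimal) (auto simp del: nil_products.simps)
  then have "conformal_derived scale circ nil_span (card S) = {0}"
    using derived_nil_span[of "card S"] zero_in_derived[OF subspace_nil_span, of circ "card S"] by blast
  then show ?thesis unfolding conformal_solvable_def by blast
qed

lemma semisimple_imp_nil_zero:
  assumes "semisimple_conformal_algebra scale UNIV circ" and S: "finite S" "span S = UNIV"
    and x: "nil x"
  shows "x v = 0"
proof -
  interpret semisimple_conformal_algebra scale UNIV circ by fact
  have "torsion = {0}" by (rule solvable_ideal_zero[OF torsion_ideal torsion_solvable])
  then have "nil_span = {0}"
    by (rule solvable_ideal_zero[OF nil_span_ideal nil_span_solvable[OF _ S]])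
  then show ?thesis using nil_in_nil_span[OF x] by blast
qed

section \<open>Solvable ideals of the right multiplication algebra\<close>

lemma right_mult_algebra_subalgebra:
  assumes S: "finite S" "span S = UNIV"
  shows "conformal_subalgebra (Cend_scale scale) (Cend scale) Cend_lprod (right_mult_algebra scale circ)"
proof -
  interpret C: module "Cend_scale scale" by (rule module_Cend)
  let ?P = "conformal_subalgebra (Cend_scale scale) (Cend scale) Cend_lprod"
  have top: "?P (Cend scale)"
    using sub_Cend coeff_in_Cend[OF _ _ S] by (simp add: conformal_subalgebra_def)
  have "right_mult_algebra scale circ \<subseteq> Cend scale"
    unfolding right_mult_algebra_def by (rule hull_minimal) (use right_mult_Cend top in auto)
  moreover have "C.subspace (right_mult_algebra scale circ)"
    unfolding right_mult_algebra_def hull_def by (rule C.subspace_Inter) (auto simp: conformal_subalgebra_def)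
  moreover have "coeff (Cend_lprod f g) n \<in> right_mult_algebra scale circ"
    if "f \<in> right_mult_algebra scale circ" "g \<in> right_mult_algebra scale circ" for f g n
    using that unfolding right_mult_algebra_def hull_def by (auto simp: conformal_subalgebra_def)
  ultimately show ?thesis by (simp add: conformal_subalgebra_def)
qed

text \<open>
  The conformal endomorphisms all of whose values at scalars are operators of the corresponding
  degree form a conformal subalgebra. For closure under the coefficients of \<open>f\<^sub>(\<^sub>\<lambda>\<^sub>) g\<close>, recover these from
  the values \<open>f\<^sub>a \<circ> g\<^sub>c\<^sub>-\<^sub>a\<close>, which have degree \<open>c\<close> for every \<open>a\<close>.
\<close>

lemma right_mult_algebra_opalg:
  assumes S: "finite S" "span S = UNIV" and f: "f \<in> right_mult_algebra scale circ"
  shows "opalg c (Cend_at f c)"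
proof -
  interpret C: module "Cend_scale scale" by (rule module_Cend)
  let ?T = "{f \<in> Cend scale. \<forall>c. opalg c (Cend_at f c)}"
  have "coeff (Cend_lprod f g) n \<in> ?T" if f: "f \<in> ?T" and g: "g \<in> ?T" for f g n
  proof -
    have fg: "f \<in> Cend scale" "g \<in> Cend scale" using f g by auto
    have "opalg c (Cend_at (coeff (Cend_lprod f g) n) c)" for c
    proof (cases "n \<le> degree (Cend_lprod f g)")
      case False
      then show ?thesis by (simp add: coeff_eq_0 Cend_at_zero[abs_def] opalg_null)
    next
      case True
      let ?smul = "\<lambda>b (x :: 'v \<Rightarrow> 'v) v. K b (x v)"
      have mod: "module ?smul"
        by unfold_locales (auto simp: fun_eq_iff scale_right_distrib K.scale_left_distrib s1 mult.commute)
      have sub: "module.subspace ?smul (Collect (opalg c))"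
        unfolding module.subspace_def[OF mod]
        using opalg_null[of c] opalg.add[of c] opalg.scalar[of c]
        by (auto simp: zero_fun_def plus_fun_def)
      have val: "(\<Sum>n\<le>degree (Cend_lprod f g). ?smul (a ^ n) (Cend_at (coeff (Cend_lprod f g) n) c))
          \<in> Collect (opalg c)" for a
      proof -
        have "(\<Sum>n\<le>degree (Cend_lprod f g). ?smul (a ^ n) (Cend_at (coeff (Cend_lprod f g) n) c))
          = (\<lambda>v. Cend_at f a (Cend_at g (c - a) v))"
          by (simp add: fun_eq_iff sum_fun_apply Cend_lprod_at[OF fg S])
        moreover have "opalg (a + (c - a)) (\<lambda>v. Cend_at f a (Cend_at g (c - a) v))"
          using f g by (intro opalg.comp) auto
        ultimately show ?thesis by simp
      qed
      have "Cend_at (coeff (Cend_lprod f g) n) c \<in> Collect (opalg c)"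
        by (rule poly_values_in_subspace[OF mod sub, of 1 "- {0}", OF _ _ _ _ True]) (use val in auto)
      then show ?thesis by simp
    qed
    then show ?thesis using coeff_in_Cend[OF fg S] by simp
  qed
  moreover have "C.subspace ?T"
    using sub_Cend opalg.add opalg.scalar opalg_null
    unfolding C.subspace_def
    by (auto simp: Cend_at_plus[abs_def] Cend_at_zero[abs_def] Cend_at_Cend_scale[abs_def])
  ultimately have "conformal_subalgebra (Cend_scale scale) (Cend scale) Cend_lprod ?T"
    by (auto simp: conformal_subalgebra_def)
  then have "right_mult_algebra scale circ \<subseteq> ?T"
    unfolding right_mult_algebra_def
    by (rule hull_minimal[rotated]) (auto simp: right_mult_Cend opalg.right)
  then show ?thesis using f by auto
qed

text \<open>
  \<open>f\<^sub>c \<circ> f\<^sub>c = (f\<^sub>(\<^sub>c\<^sub>) f)\<^sub>2\<^sub>c\<close>, and \<open>f\<^sub>(\<^sub>c\<^sub>) f\<close> is a linear combination of coefficients of \<open>f\<^sub>(\<^sub>\<lambda>\<^sub>) f\<close>: squaring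
  an operator goes down one step in the derived series.
\<close>

lemma solvable_ideal_nil:
  assumes S: "finite S" "span S = UNIV"
    and I: "conformal_ideal (Cend_scale scale) (right_mult_algebra scale circ) Cend_lprod I"
    and f: "f \<in> conformal_derived (Cend_scale scale) Cend_lprod I m"
    and zero: "conformal_derived (Cend_scale scale) Cend_lprod I (m + j) = {0}"
  shows "nil (Cend_at f c)"
  using f zero
proof (induction j arbitrary: f m c)
  case 0
  then have "f \<in> {0}" by (simp only: add_0_right)
  then have "f = 0" by blast
  then have "Cend_at f c = (\<lambda>v. 0)" using Cend_at_zero by blast
  then show ?case
    using opalg_null by (auto simp: nil_def intro!: exI[of _ 1])
next
  case (Suc j)
  interpret C: H_module "Cend_scale scale" unfolding H_module_def by (rule module_Cend)
  interpret CK: module "\<lambda>c. C.K c" by (rule C.module_K)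
  let ?d = "conformal_derived (Cend_scale scale) Cend_lprod I"
  have R: "f \<in> right_mult_algebra scale circ"
    using Suc.prems(1) C.derived_subset_ideal[OF I] I by (auto simp: conformal_ideal_def)
  then have fC: "f \<in> Cend scale"
    using right_mult_algebra_subalgebra[OF S] by (auto simp: conformal_subalgebra_def)
  define h where "h = (\<Sum>n\<le>degree (Cend_lprod f f). Cend_scale scale [:c ^ n:] (coeff (Cend_lprod f f) n))"
  have h: "h \<in> ?d (Suc m)"
    unfolding h_def
    using C.coeff_in_derived_Suc[OF Suc.prems(1) Suc.prems(1)]
    unfolding conformal_derived.simps by (intro CK.span_sum CK.span_scale)
  have "Cend_at (sum F A) a v = (\<Sum>n\<in>A. Cend_at (F n) a v)" for F and A :: "nat set" and a v
    by (induction A rule: infinite_finite_induct)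
      (simp_all only: sum.infinite sum.empty sum.insert Cend_at_zero Cend_at_plus not_False_eq_True)
  then have sq: "Cend_at h (c + c) v = Cend_at f c (Cend_at f c v)" for v
    using Cend_lprod_at[OF fC fC S, of c "c + c" v]
    by (simp add: h_def Cend_at_Cend_scale)
  have "nil (Cend_at h (c + c))"
    by (rule Suc.IH[OF h]) (use Suc.prems(2) in simp)
  then obtain k where "\<And>v. (Cend_at h (c + c) ^^ k) v = 0" by (auto simp: nil_def)
  moreover have "Cend_at h (c + c) = Cend_at f c ^^ 2"
    by (rule ext) (simp only: sq numeral_2_eq_2 funpow.simps o_def id_def)
  ultimately have "(Cend_at f c ^^ (2 * k)) v = 0" for v by (simp add: funpow_mult)
  then show ?case using right_mult_algebra_opalg[OF S R] by (auto simp: nil_def)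
qed

lemma solvable_ideal_zero_if_nil_zero:
  assumes S: "finite S" "span S = UNIV"
    and nil: "\<And>x v. nil x \<Longrightarrow> x v = 0"
    and I: "conformal_ideal (Cend_scale scale) (right_mult_algebra scale circ) Cend_lprod I"
    and sol: "conformal_solvable (Cend_scale scale) Cend_lprod I"
  shows "I = {0}"
proof -
  obtain n where n: "conformal_derived (Cend_scale scale) Cend_lprod I (0 + n) = {0}"
    using sol by (auto simp: conformal_solvable_def)
  have "f = 0" if "f \<in> I" for f
  proof (intro ext poly_eqI)
    fix v i
    have "ev [:c:] (f v) = 0" for c
      using nil[OF solvable_ideal_nil[OF S I _ n, of f c]] that by (simp add: Cend_at_def)
    then have "coeff (f v) i \<in> {0}"
      by (intro coeff_in_subspace_if_ev[OF K.subspace_single_0 finite.emptyI]) simp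
    then show "coeff (f v) i = coeff (0 v) i" by simp
  qed
  moreover have "0 \<in> I"
    using I module.subspace_0[OF module_Cend] by (auto simp: conformal_ideal_def)
  ultimately show ?thesis by auto
qed

end

lemma conformal_algebra_restrict:
  assumes "conformal_algebra scale C lprod" "conformal_subalgebra scale C lprod S"
  shows "conformal_algebra scale S lprod"
proof -
  interpret conformal_algebra scale C lprod by fact
  have S: "S \<subseteq> C" "subspace S" "\<And>x y n. x \<in> S \<Longrightarrow> y \<in> S \<Longrightarrow> coeff (lprod x y) n \<in> S"
    using assms(2) by (auto simp: conformal_subalgebra_def)
  show ?thesis
    by unfold_locales
      (use S in \<open>auto simp: subsetD lprod_add_left lprod_add_right lprod_scale_left lprod_scale_right
        lprod_del_left lprod_del_right\<close>)
qed

theorem proposition2: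
  fixes scale :: "'k::field_char_0 poly \<Rightarrow> 'v::ab_group_add \<Rightarrow> 'v"
    and circ :: "'v \<Rightarrow> 'v \<Rightarrow> 'v poly"
  assumes "novikov_conformal_algebra scale UNIV circ"
    and "finite_conformal_algebra scale UNIV circ"
    and "simple_conformal_algebra scale UNIV circ \<or> semisimple_conformal_algebra scale UNIV circ"
  shows "semisimple_conformal_algebra (Cend_scale scale) (right_mult_algebra scale circ) Cend_lprod"
proof -
  interpret finite_conformal_algebra scale UNIV circ by fact
  interpret novikov_operators scale circ
    unfolding novikov_operators_def by fact
  obtain S where S: "finite S" "span S = UNIV" using finitely_generated by blast
  have semisimple: "semisimple_conformal_algebra scale UNIV circ"
    using assms(3) simple_conformal_algebra.semisimple by blast
  have alg: "conformal_algebra (Cend_scale scale) (right_mult_algebra scale circ) Cend_lprod"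
    by (rule conformal_algebra_restrict[OF Cend_conformal_algebra[OF assms(2)] right_mult_algebra_subalgebra[OF S]])
  have nil: "x v = 0" if "nil x" for x v
    by (rule semisimple_imp_nil_zero[OF semisimple S that])
  show ?thesis
    unfolding semisimple_conformal_algebra_def semisimple_conformal_algebra_axioms_def
    by (intro conjI alg allI impI) (rule solvable_ideal_zero_if_nil_zero[OF S]; (rule nil)?; assumption)
qed

end
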